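(* Let $n\ge 1$ and let $f,g:\mathbb{R}^n\to[0,\infty)$ be Borel functions satisfying the duality relation $$\forall x,y\in\mathbb{R}^n,\qquad f(x)\,g(y)\leq e^{-\langle x,y\rangle}.$$ If $f$ has its barycenter at $0$, or if $g$ has its barycenter at $0$, then $$\int_{\mathbb{R}^n} f(x)\,dx\;\int_{\mathbb{R}^n} g(y)\,dy\;\leq\;(2\pi)^n .$$
   Context: $\langle x,y\rangle$ denotes the standard inner product on $\mathbb{R}^n$, $|x|$ the Euclidean norm, and integrals are with respect to Lebesgue measure. A non-negative Borel function $h$ on $\mathbb{R}^n$ is said to have a barycenter if $0<\int_{\mathbb{R}^n} h<\infty$ and $\int_{\mathbb{R}^n}|x|\,h(x)\,dx<\infty$; its barycenter (center of mass) is then $\mathrm{bar}(h)=\bigl(\int_{\mathbb{R}^n} h\bigr)^{-1}\int_{\mathbb{R}^n} x\,h(x)\,dx\in\mathbb{R}^n$. "$h$ has its barycenter at $0$" means that $h$ has a barycenter in this sense and $\mathrm{bar}(h)=0$. *)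

theory Defs
  imports "HOL-Analysis.Analysis"
begin

text \<open>Both notions are meant for non-negative Borel functions. Total mass and first absolute moment
  are taken in \<open>[0,\<infinity>]\<close>, so finiteness is a genuine condition; the Bochner integrals in
  \<open>barycenter\<close> are meaningful once \<open>has_barycenter\<close> holds.\<close>

definition has_barycenter :: "('a::euclidean_space \<Rightarrow> real) \<Rightarrow> bool" where
  "has_barycenter h \<longleftrightarrow>
     0 < (\<integral>\<^sup>+ x. ennreal (h x) \<partial>lborel) \<and>
     (\<integral>\<^sup>+ x. ennreal (h x) \<partial>lborel) < \<infinity> \<and>
     (\<integral>\<^sup>+ x. ennreal (norm x * h x) \<partial>lborel) < \<infinity>"

definition barycenter :: "('a::euclidean_space \<Rightarrow> real) \<Rightarrow> 'a" where
  "barycenter h = inverse (\<integral>x. h x \<partial>lborel) *\<^sub>R (\<integral>x. h x *\<^sub>R x \<partial>lborel)"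

end

theory Submission
  imports Defs "HOL-Probability.Distributions" "HOL-Probability.Distribution_Functions"
begin

text \<open>This is Lehec's induction on the dimension. On a pair of half-lines the inequality, with
  constant \<open>\<pi>/2\<close>, is the Prekopa-Leindler inequality after the substitution \<open>x = exp s\<close>. For the step,
  cut the mass of \<open>f\<close> into two equal halves by a hyperplane \<open>x\<^sub>j = m\<close>. The line joining the barycenters
  of the two halves meets it in a point \<open>z\<close>; integrating along the direction of this line turns each
  half of \<open>f\<close> into a function on the hyperplane with barycenter \<open>z\<close>, so the induction hypothesis and
  the half-line inequality apply. Adding the two halves gives the bound for \<open>f(z + \<cdot>)\<close> and any dual \<open>g\<close>.
  If \<open>f(x) g(y) \<le> exp (-\<langle>x,y\<rangle>)\<close>, then \<open>g(y) exp \<langle>y,z\<rangle>\<close> is dual to \<open>f(z + \<cdot>)\<close>, and Jensen's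
  inequality removes the factor \<open>exp \<langle>y,z\<rangle>\<close> when \<open>g\<close> has its barycenter at \<open>0\<close>.\<close>

section \<open>One-dimensional inequalities: Brunn-Minkowski, Prekopa-Leindler and the half-line
  case\<close>

lemma nn_integral_half_gaussian:
  "(\<integral>\<^sup>+x. ennreal (exp (- (x\<^sup>2 / 2))) * indicator {0..} x \<partial>lborel) = ennreal (sqrt (pi / 2))"
proof -
  have "(\<integral>\<^sup>+x. ennreal (indicator {0..} x *\<^sub>R exp (- x\<^sup>2)) \<partial>lborel) = ennreal (sqrt pi / 2)"
    using gaussian_moment_0 by (intro nn_integral_eq_integral[THEN trans])
      (auto simp: has_bochner_integral_iff)
  then have "ennreal (sqrt pi / 2)
      = (\<integral>\<^sup>+x. ennreal (exp (- x\<^sup>2)) * indicator {0..} x \<partial>lborel)"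
    by (subst (asm) nn_integral_cong[where v = "\<lambda>x. ennreal (exp (- x\<^sup>2)) * indicator {0..} x"])
      (auto simp: indicator_def)
  also have "\<dots> = ennreal (1 / sqrt 2) *
      (\<integral>\<^sup>+x. ennreal (exp (- (x\<^sup>2 / 2))) * indicator {0..} x \<partial>lborel)"
    by (subst nn_integral_real_affine[where c = "1 / sqrt 2" and t = 0])
      (auto simp: power_divide indicator_def zero_le_divide_iff intro!: arg_cong2[where f = times] nn_integral_cong)
  finally have "ennreal (sqrt 2) * ennreal (sqrt pi / 2) = ennreal (sqrt 2) * (ennreal (1 / sqrt 2) *
      (\<integral>\<^sup>+x. ennreal (exp (- (x\<^sup>2 / 2))) * indicator {0..} x \<partial>lborel))"
    by simp
  also have "\<dots> = (\<integral>\<^sup>+x. ennreal (exp (- (x\<^sup>2 / 2))) * indicator {0..} x \<partial>lborel)"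
    by (simp add: mult.assoc[symmetric] ennreal_mult'[symmetric])
  also have "ennreal (sqrt 2) * ennreal (sqrt pi / 2) = ennreal (sqrt (pi / 2))"
    by (subst ennreal_mult'[symmetric]) (auto simp: real_sqrt_divide field_simps)
  finally show ?thesis ..
qed

lemma translate_image_borel:
  fixes c :: real
  assumes "A \<in> sets borel"
  shows "(\<lambda>x. x + c) ` A \<in> sets borel"
    and "emeasure lborel ((\<lambda>x. x + c) ` A) = emeasure lborel A"
proof -
  have eq: "(\<lambda>x. x + c) ` A = (+) (- c) -` A"
  proof (intro set_eqI)
    fix x show "x \<in> (\<lambda>x. x + c) ` A \<longleftrightarrow> x \<in> (+) (- c) -` A"
      by (auto intro: image_eqI[of x _ "x - c"])
  qed
  show "(\<lambda>x. x + c) ` A \<in> sets borel"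
    unfolding eq using assms by (intro measurable_sets_borel[of _ borel]) simp_all
  have "emeasure lborel ((+) (- c) -` A) = emeasure (distr lborel borel ((+) (- c))) A"
    using assms by (subst emeasure_distr) (auto simp: vimage_def)
  then show "emeasure lborel ((\<lambda>x. x + c) ` A) = emeasure lborel A"
    unfolding eq by (simp add: lborel_distr_plus)
qed

text \<open>The translates \<open>A + b\<close> and \<open>B + a\<close> with \<open>a\<close> near \<open>Sup A\<close> and \<open>b\<close> near \<open>Inf B\<close> lie in \<open>C\<close> and
  overlap in a set of measure at most \<open>e\<close>.\<close>

lemma one_dim_brunn_minkowski:
  fixes A B C :: "real set"
  assumes [measurable]: "A \<in> sets borel" "B \<in> sets borel" "C \<in> sets borel"
    and "A \<noteq> {}" "B \<noteq> {}" "bounded A" "bounded B"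
    and sum: "\<And>a b. a \<in> A \<Longrightarrow> b \<in> B \<Longrightarrow> a + b \<in> C"
  shows "emeasure lborel A + emeasure lborel B \<le> emeasure lborel C"
proof (rule ennreal_le_epsilon)
  fix e :: real assume "e > 0"
  have bA: "bdd_above A" and bB: "bdd_below B"
    using assms bounded_imp_bdd_above bounded_imp_bdd_below by auto
  obtain a where a: "a \<in> A" "Sup A - e / 2 < a"
    using less_cSup_iff[OF \<open>A \<noteq> {}\<close> bA, of "Sup A - e / 2"] \<open>e > 0\<close> by auto
  obtain b where b: "b \<in> B" "b < Inf B + e / 2"
    using cInf_less_iff[OF \<open>B \<noteq> {}\<close> bB, of "Inf B + e / 2"] \<open>e > 0\<close> by auto
  let ?A = "(\<lambda>x. x + b) ` A" and ?B = "(\<lambda>x. x + a) ` B" and ?D = "{a + Inf B .. Sup A + b}"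
  have [measurable]: "?A \<in> sets borel" "?B \<in> sets borel"
    by (auto intro: translate_image_borel)
  have "x + b \<le> Sup A + b" if "x \<in> A" for x using cSup_upper[OF that bA] by simp
  moreover have "a + Inf B \<le> y + a" if "y \<in> B" for y using cInf_lower[OF that bB] by simp
  ultimately have D: "?A \<inter> ?B \<subseteq> ?D" by fastforce
  have AB: "?A \<union> ?B \<subseteq> C" using sum a b by (auto, metis add.commute)
  have "emeasure lborel A + emeasure lborel B = emeasure lborel ?A + emeasure lborel ?B"
    by (simp add: translate_image_borel)
  also have "\<dots> = emeasure lborel (?A \<union> ?B) + emeasure lborel (?A \<inter> ?B)"
    by (rule emeasure_Un_Int) auto
  also have "\<dots> \<le> emeasure lborel C + emeasure lborel ?D"
    using D AB by (intro add_mono emeasure_mono) auto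
  also have "emeasure lborel ?D \<le> ennreal e"
  proof (cases "a + Inf B \<le> Sup A + b")
    case True then show ?thesis using a b by (auto intro!: ennreal_leI)
  qed auto
  finally show "emeasure lborel A + emeasure lborel B \<le> emeasure lborel C + ennreal e"
    by (simp add: add_left_mono)
qed

text \<open>Both sides are the area of the region \<open>0 < t < min 1 (p x)\<close>, sliced in the
  two orders. The levels stop at 1 because \<open>p\<close> and \<open>q\<close> will be scaled to
  supremum 1: below that level their superlevel sets are nonempty, as Brunn-Minkowski
  requires.\<close>

lemma nn_integral_layers:
  fixes p :: "real \<Rightarrow> real"
  assumes [measurable]: "p \<in> borel_measurable borel" and nn: "\<And>x. p x \<ge> 0"
  shows "(\<integral>\<^sup>+t. emeasure lborel {x. t < p x} * indicator {0<..<1} t \<partial>lborel)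
    = (\<integral>\<^sup>+x. ennreal (min 1 (p x)) \<partial>lborel)"
proof -
  have "(\<integral>\<^sup>+t. emeasure lborel {x. t < p x} * indicator {0<..<1} t \<partial>lborel)
    = (\<integral>\<^sup>+t. (\<integral>\<^sup>+x. indicator {0<..<min 1 (p x)} t \<partial>lborel) \<partial>lborel)"
  proof (intro nn_integral_cong)
    fix t :: real
    have "emeasure lborel {x. t < p x} * indicator {0<..<1} t
        = (\<integral>\<^sup>+x. indicator {0<..<1} t * indicator {x. t < p x} x \<partial>lborel)"
      by (subst nn_integral_cmult_indicator) (auto simp: mult.commute)
    also have "\<dots> = (\<integral>\<^sup>+x. indicator {0<..<min 1 (p x)} t \<partial>lborel)"
      by (intro nn_integral_cong) (auto simp: indicator_def)
    finally show "emeasure lborel {x. t < p x} * indicator {0<..<1} t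
        = (\<integral>\<^sup>+x. indicator {0<..<min 1 (p x)} t \<partial>lborel)" .
  qed
  also have "\<dots> = (\<integral>\<^sup>+x. (\<integral>\<^sup>+t. indicator {0<..<min 1 (p x)} t \<partial>lborel) \<partial>lborel)"
  proof (rule lborel_pair.Fubini')
    have "(\<lambda>z. indicator {z. 0 < snd z \<and> snd z < min 1 (p (fst z))} z :: ennreal)
        \<in> borel_measurable (lborel \<Otimes>\<^sub>M lborel)" by measurable
    also have "(\<lambda>z. indicator {z. 0 < snd z \<and> snd z < min 1 (p (fst z))} z :: ennreal)
        = (\<lambda>(x, t). indicator {0<..<min 1 (p x)} t)"
      by (auto simp: indicator_def fun_eq_iff)
    finally show "(\<lambda>(x, t). indicator {0<..<min 1 (p x)} t :: ennreal)
        \<in> borel_measurable (lborel \<Otimes>\<^sub>M lborel)" .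
  qed
  also have "\<dots> = (\<integral>\<^sup>+x. ennreal (min 1 (p x)) \<partial>lborel)"
    using nn by (intro nn_integral_cong) auto
  finally show ?thesis .
qed

text \<open>After division by the suprema, the superlevel sets of \<open>p\<close> and
  \<open>q\<close> are nonempty at every level in (0,1), and their sum lies in a superlevel set of a
  multiple of \<open>H\<close>. Brunn-Minkowski, integrated over the levels, bounds the sum of the
  normalised integrals, and the arithmetic-geometric mean inequality turns this into a bound for the
  product. The factor 4 appears because \<open>H\<close> is evaluated at \<open>s + t\<close> and
  not at the midpoint.\<close>

lemma one_dim_prekopa_leindler:
  fixes p q H :: "real \<Rightarrow> real"
  assumes [measurable]: "p \<in> borel_measurable borel" "q \<in> borel_measurable borel" "H \<in> borel_measurable borel"
    and nn: "\<And>x. p x \<ge> 0" "\<And>x. q x \<ge> 0" "\<And>x. H x \<ge> 0"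
    and bd: "bdd_above (range p)" "bdd_above (range q)"
    and supp: "\<And>x. \<bar>x\<bar> > L \<Longrightarrow> p x = 0" "\<And>x. \<bar>x\<bar> > L \<Longrightarrow> q x = 0"
    and le: "\<And>s t. p s * q t \<le> (H (s + t))\<^sup>2"
  shows "4 * ((\<integral>\<^sup>+x. p x \<partial>lborel) * (\<integral>\<^sup>+x. q x \<partial>lborel)) \<le> (\<integral>\<^sup>+x. H x \<partial>lborel)\<^sup>2"
proof -
  define a b where "a = Sup (range p)" and "b = Sup (range q)"
  have pa: "p x \<le> a" for x unfolding a_def by (rule cSup_upper) (use bd in auto)
  have qb: "q x \<le> b" for x unfolding b_def by (rule cSup_upper) (use bd in auto)
  show ?thesis
  proof (cases "a = 0 \<or> b = 0")
    case True
    then have "(\<forall>x. p x = 0) \<or> (\<forall>x. q x = 0)"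
      using pa qb nn by (metis antisym)
    then show ?thesis by auto
  next
    case False
    then have a: "a > 0" and b: "b > 0" using pa[of 0] qb[of 0] nn[of 0] by linarith+
    \<comment> \<open>With the geometric mean of the suprema, \<open>t < p x / a\<close> and
      \<open>t < q y / b\<close> multiply to
      \<open>t\<^sup>2 < (H (x + y) / c)\<^sup>2\<close>.\<close>
    define c where "c = sqrt (a * b)"
    have c: "c > 0" and c2: "c\<^sup>2 = a * b" using a b by (auto simp: c_def)
    have layers: "emeasure lborel {x. t < p x / a} + emeasure lborel {x. t < q x / b}
        \<le> emeasure lborel {x. t < H x / c}" if t: "0 < t" "t < 1" for t
    proof (rule one_dim_brunn_minkowski)
      have "t * a < a" using t a by simp
      then obtain x where "t * a < p x"
        using less_cSup_iff[of "range p" "t * a"] bd by (auto simp: a_def)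
      then show "{x. t < p x / a} \<noteq> {}" using a by (auto simp: field_simps)
      have "t * b < b" using t b by simp
      then obtain x where "t * b < q x"
        using less_cSup_iff[of "range q" "t * b"] bd by (auto simp: b_def)
      then show "{x. t < q x / b} \<noteq> {}" using b by (auto simp: field_simps)
      have "{x. t < p x / a} \<subseteq> {-L..L}" "{x. t < q x / b} \<subseteq> {-L..L}"
        using supp t by (smt (verit) div_0 atLeastAtMost_iff mem_Collect_eq subsetI)+
      then show "bounded {x. t < p x / a}" "bounded {x. t < q x / b}"
        using bounded_closed_interval bounded_subset by blast+
      fix x y assume "x \<in> {x. t < p x / a}" "y \<in> {x. t < q x / b}"
      then have "t < p x / a" "t < q y / b" by auto
      then have "t * t < (p x / a) * (q y / b)"
        using t by (intro mult_strict_mono) auto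
      also have "\<dots> \<le> (H (x + y))\<^sup>2 / (a * b)"
        using le[of x y] a b by (simp add: divide_right_mono)
      also have "\<dots> = (H (x + y) / c)\<^sup>2" by (simp add: power_divide c2)
      finally have "t\<^sup>2 < (H (x + y) / c)\<^sup>2" by (simp add: power2_eq_square)
      then have "t < H (x + y) / c"
        using c nn(3) by (intro power_less_imp_less_base[of t 2]) auto
      then show "x + y \<in> {x. t < H x / c}" by simp
    qed measurable
    define X Y where "X = (\<integral>\<^sup>+x. ennreal (p x) \<partial>lborel)" and "Y = (\<integral>\<^sup>+x. ennreal (q x) \<partial>lborel)"
    define Z where "Z = (\<integral>\<^sup>+x. ennreal (H x) \<partial>lborel)"
    have scale: "(\<integral>\<^sup>+x. ennreal (h x / d) \<partial>lborel) = ennreal (1 / d) * (\<integral>\<^sup>+x. ennreal (h x) \<partial>lborel)"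
      if [measurable]: "h \<in> borel_measurable borel" and "d > 0" "\<And>x. h x \<ge> 0" for h and d :: real
      using that by (subst nn_integral_cmult[symmetric]) (auto simp: ennreal_mult'[symmetric] mult.commute)
    have "ennreal (1 / a) * X + ennreal (1 / b) * Y
        = (\<integral>\<^sup>+x. ennreal (min 1 (p x / a)) \<partial>lborel) + (\<integral>\<^sup>+x. ennreal (min 1 (q x / b)) \<partial>lborel)"
      using pa qb a b nn by (simp add: scale[symmetric] X_def Y_def min_absorb2)
    also have "\<dots> = (\<integral>\<^sup>+t. emeasure lborel {x. t < p x / a} * indicator {0<..<1} t
        + emeasure lborel {x. t < q x / b} * indicator {0<..<1} t \<partial>lborel)"
    proof (subst nn_integral_add)
    qed (use a b nn in \<open>simp_all add: nn_integral_layers\<close>)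
    also have "\<dots> \<le> (\<integral>\<^sup>+t. emeasure lborel {x. t < H x / c} * indicator {0<..<1} t \<partial>lborel)"
      using layers by (intro nn_integral_mono) (auto simp: indicator_def)
    \<comment> \<open>\<open>H / c\<close> may exceed 1; dropping the cut at 1 only enlarges the
      upper bound.\<close>
    also have "\<dots> \<le> (\<integral>\<^sup>+x. ennreal (H x / c) \<partial>lborel)"
      using c nn by (subst nn_integral_layers) (auto intro!: nn_integral_mono ennreal_leI)
    also have "\<dots> = ennreal (1 / c) * Z"
      using c nn by (simp add: scale Z_def)
    finally have main: "ennreal (1 / a) * X + ennreal (1 / b) * Y \<le> ennreal (1 / c) * Z" .
    have fin: "(\<integral>\<^sup>+x. ennreal (h x) \<partial>lborel) < \<infinity>"
      if "\<And>x. h x \<le> d" "d > 0" "\<And>x. \<bar>x\<bar> > L \<Longrightarrow> h x = 0" for h and d :: real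
    proof -
      have "(\<integral>\<^sup>+x. ennreal (h x) \<partial>lborel) \<le> (\<integral>\<^sup>+x. ennreal d * indicator {-L..L} x \<partial>lborel)"
      proof (intro nn_integral_mono)
        fix x show "ennreal (h x) \<le> ennreal d * indicator {-L..L} x"
          using that by (cases "x \<in> {-L..L}") (auto intro!: ennreal_leI simp: abs_less_iff)
      qed
      also have "\<dots> < \<infinity>"
        by (subst nn_integral_cmult_indicator) (auto simp: ennreal_mult_less_top emeasure_lborel_Icc_eq)
      finally show ?thesis .
    qed
    obtain x where x: "X = ennreal x" "x \<ge> 0"
      using fin[of p a] pa a supp(1) by (cases X) (auto simp: X_def)
    obtain y where y: "Y = ennreal y" "y \<ge> 0"
      using fin[of q b] qb b supp(2) by (cases Y) (auto simp: Y_def)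
    show ?thesis
    proof (cases Z)
      case (real z)
      have "x / a + y / b \<le> z / c"
        using main x y real a b c
        by (simp add: ennreal_mult'[symmetric] ennreal_plus[symmetric] del: ennreal_plus)
      then have "(x / a + y / b)\<^sup>2 \<le> (z / c)\<^sup>2"
        using x y a b by (intro power_mono) auto
      \<comment> \<open>Arithmetic-geometric mean inequality. The product on the left carries
        \<open>1 / (a * b)\<close>, which is also the factor \<open>1 / c\<^sup>2\<close> of the
        upper bound, so the suprema cancel.\<close>
      moreover have "4 * ((x / a) * (y / b)) \<le> (x / a + y / b)\<^sup>2"
        using sum_squares_bound[of "x / a" "y / b"] by (simp only: power2_sum)
      ultimately have "4 * (x * y) / (a * b) \<le> z\<^sup>2 / (a * b)"
        by (simp add: power_divide c2)
      then have "4 * (x * y) \<le> z\<^sup>2"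
        using a b by (simp add: divide_le_cancel zero_less_mult_iff not_less)
      then have "ennreal (4 * (x * y)) \<le> ennreal (z\<^sup>2)" by (rule ennreal_leI)
      then have "4 * (X * Y) \<le> Z\<^sup>2"
        using x y real by (simp add: ennreal_mult' ennreal_power)
      then show ?thesis by (simp add: X_def Y_def Z_def)
    next
      case top
      then show ?thesis unfolding Z_def[symmetric] by (simp add: power2_eq_square)
    qed
  qed
qed

text \<open>Monotone convergence: the truncations increase to \<open>f\<close> on the union of the
  windows. One factor of a product of integrals is released at a time, while the other one is kept
  as the constant \<open>Y\<close>, which may be infinite.\<close>

lemma nn_integral_truncation_mult_le:
  fixes f :: "'a \<Rightarrow> ennreal" and W :: "nat \<Rightarrow> 'a set"
  assumes [measurable]: "f \<in> borel_measurable M" "\<And>k. W k \<in> sets M"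
    and "incseq W"
    and le: "\<And>k. (\<integral>\<^sup>+x. min (f x) (of_nat k) * indicator (W k) x \<partial>M) * Y \<le> C"
  shows "(\<integral>\<^sup>+x. f x * indicator (\<Union>k. W k) x \<partial>M) * Y \<le> C"
proof -
  have sup: "(SUP k. min (f x) (of_nat k) * indicator (W k) x) = f x * indicator (\<Union>k. W k) x" for x
  proof (cases "x \<in> (\<Union>k. W k)")
    case True
    then obtain k0 where k0: "x \<in> W k0" by auto
    \<comment> \<open>From index \<open>k0\<close> on the windows contain \<open>x\<close>, so the
      term with index \<open>k0 + k\<close> dominates the truncation at height
      \<open>k\<close>.\<close>
    have inW: "x \<in> W (k0 + k)" for k using k0 incseqD[OF \<open>incseq W\<close>, of k0 "k0 + k"] by auto
    have "f x \<le> (SUP k. min (f x) (of_nat k) * indicator (W k) x)"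
    proof -
      have "f x = (SUP k::nat. min (f x) (of_nat k))"
        by (simp add: inf_min[symmetric] inf_SUP[symmetric] ennreal_SUP_of_nat_eq_top)
      also have "\<dots> \<le> (SUP k. min (f x) (of_nat k) * indicator (W k) x)"
      proof (rule SUP_least)
        fix k :: nat
        have "min (f x) (of_nat k) \<le> min (f x) (of_nat (k0 + k)) * indicator (W (k0 + k)) x"
          using inW[of k] by (simp add: min.coboundedI2)
        also have "\<dots> \<le> (SUP k. min (f x) (of_nat k) * indicator (W k) x)"
          by (rule SUP_upper) simp
        finally show "min (f x) (of_nat k) \<le> (SUP k. min (f x) (of_nat k) * indicator (W k) x)" .
      qed
      finally show ?thesis .
    qed
    moreover have "(SUP k. min (f x) (of_nat k) * indicator (W k) x) \<le> f x"
      by (rule SUP_least) (auto simp: indicator_def)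
    ultimately show ?thesis using True by simp
  next
    case False
    then show ?thesis by simp
  qed
  have "(\<integral>\<^sup>+x. f x * indicator (\<Union>k. W k) x \<partial>M)
      = (\<integral>\<^sup>+x. (SUP k. min (f x) (of_nat k) * indicator (W k) x) \<partial>M)"
    by (simp add: sup)
  also have "\<dots> = (SUP k. \<integral>\<^sup>+x. min (f x) (of_nat k) * indicator (W k) x \<partial>M)"
  proof (rule nn_integral_monotone_convergence_SUP)
    show "incseq (\<lambda>k x. min (f x) (of_nat k) * indicator (W k) x)"
      using \<open>incseq W\<close> by (auto simp: incseq_def le_fun_def indicator_def min_le_iff_disj)
  qed measurable
  finally show ?thesis
    using le by (simp add: SUP_mult_right_ennreal SUP_least)
qed

text \<open>Putting \<open>x = exp s\<close> replaces \<open>f\<close> and \<open>g\<close> by their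
  lifts and multiplies the duality bound by \<open>exp (s + t)\<close>, after which it depends on
  \<open>s + t\<close> alone. \<open>H\<close> is the square root of this bound, and its integral is
  at most \<open>2 * sqrt (pi / 2)\<close>, so the factor 4 of Prekopa-Leindler cancels.\<close>

lemma half_line_santalo_bounded:
  fixes f g :: "real \<Rightarrow> real"
  assumes [measurable]: "f \<in> borel_measurable borel" "g \<in> borel_measurable borel"
    and nn: "\<And>x. f x \<ge> 0" "\<And>x. g x \<ge> 0"
    and bd: "\<And>x. f x \<le> K" "\<And>x. g x \<le> K"
    and "L > 0"
    and supp: "\<And>x. x \<notin> {exp (- L)..exp L} \<Longrightarrow> f x = 0" "\<And>x. x \<notin> {exp (- L)..exp L} \<Longrightarrow> g x = 0"
    and dual: "\<And>x y. x > 0 \<Longrightarrow> y > 0 \<Longrightarrow> f x * g y \<le> exp (- (x * y))"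
  shows "(\<integral>\<^sup>+x. f x \<partial>lborel) * (\<integral>\<^sup>+x. g x \<partial>lborel) \<le> ennreal (pi / 2)"
proof -
  define lift where "lift h s = h (exp s) * exp s" for h :: "real \<Rightarrow> real" and s
  \<comment> \<open>The lifts vanish outside \<open>{-L..L}\<close>, so only sums up to
    \<open>2 * L\<close> in absolute value matter. The cut-off keeps the later substitution on a
    compact interval.\<close>
  define H :: "real \<Rightarrow> real" where
    "H r = exp (- (exp r / 2)) * exp (r / 2) * indicator {- (2 * L)..2 * L} r" for r
  have [measurable]: "lift f \<in> borel_measurable borel" "lift g \<in> borel_measurable borel"
    "H \<in> borel_measurable borel"
    unfolding lift_def[abs_def] H_def[abs_def] by measurable
  have "K \<ge> 0" using nn(1)[of 0] bd(1)[of 0] by linarith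
  have lift_supp: "lift h s = 0" if "\<bar>s\<bar> > L" "\<And>x. x \<notin> {exp (- L)..exp L} \<Longrightarrow> h x = 0" for h s
  proof -
    have "exp s \<notin> {exp (- L)..exp L}" using that(1) by auto
    then show ?thesis using that(2) by (simp add: lift_def)
  qed
  have lift_bd: "bdd_above (range (lift h))"
    if h: "\<And>x. h x \<ge> 0" "\<And>x. h x \<le> K" "\<And>x. x \<notin> {exp (- L)..exp L} \<Longrightarrow> h x = 0" for h
  proof (rule bdd_aboveI2)
    fix s show "lift h s \<le> K * exp L"
    proof (cases "\<bar>s\<bar> > L")
      case True then show ?thesis using lift_supp[OF True h(3)] \<open>K \<ge> 0\<close> by simp
    next
      case False then show ?thesis
        using h \<open>K \<ge> 0\<close> by (auto simp: lift_def intro!: mult_mono)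
    qed
  qed
  have lift_int: "(\<integral>\<^sup>+s. lift h s \<partial>lborel) = (\<integral>\<^sup>+x. h x \<partial>lborel)"
    if [measurable]: "h \<in> borel_measurable borel"
      and h: "\<And>x. h x \<ge> 0" "\<And>x. x \<notin> {exp (- L)..exp L} \<Longrightarrow> h x = 0" for h
  proof -
    have "(\<integral>\<^sup>+x. ennreal (h x) \<partial>lborel)
        = (\<integral>\<^sup>+x. ennreal (h x) * indicator {exp (- L)..exp L} x \<partial>lborel)"
      using h(2) by (intro nn_integral_cong) (auto simp: indicator_def)
    also have "\<dots> = (\<integral>\<^sup>+s. ennreal (h (exp s)) * exp s * indicator {-L..L} s \<partial>lborel)"
      by (rule nn_integral_substitution_aux)
        (use \<open>L > 0\<close> in \<open>auto intro!: derivative_eq_intros continuous_intros\<close>)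
    also have "\<dots> = (\<integral>\<^sup>+s. lift h s \<partial>lborel)"
    proof (intro nn_integral_cong)
      fix s show "ennreal (h (exp s)) * exp s * indicator {-L..L} s = lift h s"
        using lift_supp[OF _ h(2), of s] h(1)
        by (cases "\<bar>s\<bar> > L") (auto simp: lift_def indicator_def ennreal_mult')
    qed
    finally show ?thesis ..
  qed
  have "4 * ((\<integral>\<^sup>+s. lift f s \<partial>lborel) * (\<integral>\<^sup>+s. lift g s \<partial>lborel)) \<le> (\<integral>\<^sup>+r. H r \<partial>lborel)\<^sup>2"
  proof (rule one_dim_prekopa_leindler)
    show "lift f s * lift g t \<le> (H (s + t))\<^sup>2" for s t
    proof (cases "\<bar>s\<bar> > L \<or> \<bar>t\<bar> > L")
      case True
      then have "lift f s * lift g t = 0" using lift_supp supp by auto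
      then show ?thesis by (simp only: zero_le_power2)
    next
      case False
      have "lift f s * lift g t = (f (exp s) * g (exp t)) * exp (s + t)"
        by (simp add: lift_def exp_add)
      also have "\<dots> \<le> exp (- (exp s * exp t)) * exp (s + t)"
        using dual by (intro mult_right_mono) auto
      also have "\<dots> = (H (s + t))\<^sup>2"
      proof -
        have "s + t \<in> {- (2 * L)..2 * L}" using False by auto
        then show ?thesis
          by (simp add: H_def power2_eq_square exp_add[symmetric] del: atLeastAtMost_iff)
      qed
      finally show ?thesis .
    qed
    show "lift f x = 0" "lift g x = 0" if "\<bar>x\<bar> > L" for x
      using lift_supp[OF that, of f] lift_supp[OF that, of g] supp by blast+
    show "bdd_above (range (lift f))"
      by (rule lift_bd) (fact nn bd supp)+
    show "bdd_above (range (lift g))"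
      by (rule lift_bd) (fact nn bd supp)+
  qed (use nn in \<open>auto simp: H_def lift_def\<close>)
  \<comment> \<open>For \<open>u = exp (r / 2)\<close> one has \<open>u\<^sup>2 = exp r\<close> and
    \<open>du = (u / 2) dr\<close>, so \<open>H r dr\<close> becomes twice the Gaussian
    \<open>exp (- (u\<^sup>2 / 2)) du\<close>. The integrand is first brought into the shape of this
    substitution.\<close>
  also have "(\<integral>\<^sup>+r. H r \<partial>lborel)
      = (\<integral>\<^sup>+r. 2 * ennreal (exp (- ((exp (r / 2))\<^sup>2 / 2))) * (exp (r / 2) / 2) * indicator {- (2 * L)..2 * L} r \<partial>lborel)"
  proof (intro nn_integral_cong)
    fix r :: real
    have "(exp (r / 2))\<^sup>2 = exp r" by (simp add: power2_eq_square exp_add[symmetric])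
    moreover have "2 * ennreal a * ennreal (b / 2) = ennreal (a * b)" if "a \<ge> 0" "b \<ge> 0" for a b
    proof -
      have "2 * ennreal a * ennreal (b / 2) = ennreal (2 * a * (b / 2))"
        using that ennreal_mult[of "2 * a" "b / 2"] ennreal_mult[of 2 a] by simp
      then show ?thesis by (simp only: times_divide_eq_right nonzero_mult_div_cancel_left
            mult.assoc mult.left_commute[of _ 2])
    qed
    ultimately show "ennreal (H r) = 2 * ennreal (exp (- ((exp (r / 2))\<^sup>2 / 2))) * (exp (r / 2) / 2)
        * indicator {- (2 * L)..2 * L} r"
      by (auto simp: H_def indicator_def)
  qed
  also have "\<dots> = (\<integral>\<^sup>+u. 2 * ennreal (exp (- (u\<^sup>2 / 2)))
      * indicator {exp (- (2 * L) / 2)..exp (2 * L / 2)} u \<partial>lborel)"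
    by (rule nn_integral_substitution_aux[symmetric])
      (use \<open>L > 0\<close> in \<open>auto intro!: derivative_eq_intros continuous_intros\<close>)
  also have "\<dots> \<le> (\<integral>\<^sup>+u. 2 * (ennreal (exp (- (u\<^sup>2 / 2))) * indicator {0..} u) \<partial>lborel)"
    by (intro nn_integral_mono) (auto simp: indicator_def intro: order_trans[OF exp_ge_zero])
  also have "\<dots> = 2 * ennreal (sqrt (pi / 2))"
    by (simp add: nn_integral_cmult nn_integral_half_gaussian)
  also have "(2 * ennreal (sqrt (pi / 2)))\<^sup>2 = 4 * ennreal (pi / 2)"
    by (simp add: power_mult_distrib ennreal_power)
  finally have "4 * ((\<integral>\<^sup>+s. lift f s \<partial>lborel) * (\<integral>\<^sup>+s. lift g s \<partial>lborel)) \<le> 4 * ennreal (pi / 2)"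
    by (simp add: power_mono)
  moreover have "(\<integral>\<^sup>+s. lift f s \<partial>lborel) = (\<integral>\<^sup>+x. f x \<partial>lborel)"
    "(\<integral>\<^sup>+s. lift g s \<partial>lborel) = (\<integral>\<^sup>+x. g x \<partial>lborel)"
    by (rule lift_int; fact)+
  ultimately show ?thesis
    by (simp add: ennreal_mult_le_mult_iff)
qed

text \<open>Windows exhausting the open half-line and growing heights reduce this to bounded
  functions. The two truncations have independent indices \<open>k\<close> and \<open>l\<close>, so
  the limits can be taken one after the other.\<close>

lemma half_line_santalo:
  fixes f g :: "real \<Rightarrow> ennreal"
  assumes [measurable]: "f \<in> borel_measurable borel" "g \<in> borel_measurable borel"
    and dual: "\<And>x y. x > 0 \<Longrightarrow> y > 0 \<Longrightarrow> f x * g y \<le> ennreal (exp (- (x * y)))"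
  shows "(\<integral>\<^sup>+x. f x * indicator {0<..} x \<partial>lborel) * (\<integral>\<^sup>+y. g y * indicator {0<..} y \<partial>lborel)
    \<le> ennreal (pi / 2)"
proof -
  define W :: "nat \<Rightarrow> real set" where "W k = {exp (- real k)..exp (real k)}" for k
  have incW: "incseq W" by (auto simp: incseq_def W_def intro: order_trans)
  have UW: "(\<Union>k. W k) = {0<..}"
  proof (intro set_eqI iffI)
    fix x :: real assume "x \<in> {0<..}"
    then have x: "x > 0" by simp
    obtain k :: nat where "\<bar>ln x\<bar> \<le> real k" using real_arch_simple by blast
    then have "exp (- real k) \<le> exp (ln x)" "exp (ln x) \<le> exp (real k)" by auto
    then have "x \<in> W k" using x by (auto simp: W_def)
    then show "x \<in> (\<Union>k. W k)" by auto
  qed (auto simp: W_def intro: less_le_trans[OF exp_gt_zero])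
  \<comment> \<open>\<open>enn2real\<close> sends infinity to 0, but the minimum with
    \<open>k\<close> is finite, so no value is lost.\<close>
  define tr where "tr h k x = enn2real (min (h x) (of_nat k)) * indicator (W k) x"
    for h :: "real \<Rightarrow> ennreal" and k :: nat and x
  have fin: "min a (of_nat k) < top" for a :: ennreal and k :: nat
    by (metis min_less_iff_disj of_nat_less_top infinity_ennreal_def)
  have tr: "ennreal (tr h k x) = min (h x) (of_nat k) * indicator (W k) x" for h k x
    using fin[of "h x" k] by (auto simp: tr_def indicator_def)
  have [measurable]: "W k \<in> sets borel" for k by (simp add: W_def)
  have [measurable]: "tr h k \<in> borel_measurable borel" if [measurable]: "h \<in> borel_measurable borel" for h k
    unfolding tr_def[abs_def] by measurable
  have trb: "0 \<le> tr h k x" "tr h k x \<le> real k" for h k x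
  proof -
    show "0 \<le> tr h k x" by (simp add: tr_def)
    have "ennreal (tr h k x) \<le> ennreal (real k)"
      unfolding tr by (auto simp: indicator_def ennreal_of_nat_eq_real_of_nat)
    then show "tr h k x \<le> real k" by (simp add: ennreal_le_iff)
  qed
  have trle: "ennreal (tr h k x) \<le> h x" for h k x
    unfolding tr by (auto simp: indicator_def)
  have "(\<integral>\<^sup>+x. min (f x) (of_nat k) * indicator (W k) x \<partial>lborel)
      * (\<integral>\<^sup>+x. min (g x) (of_nat l) * indicator (W l) x \<partial>lborel) \<le> ennreal (pi / 2)" for k l
    unfolding tr[symmetric]
  \<comment> \<open>\<open>Suc\<close> makes the bound \<open>L\<close> positive even for
    \<open>k = l = 0\<close>.\<close>
  proof (rule half_line_santalo_bounded[where K = "real (max k l)" and L = "real (Suc (max k l))"])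
    have "W k \<subseteq> W (Suc (max k l))" "W l \<subseteq> W (Suc (max k l))"
      using incseqD[OF incW, of k "Suc (max k l)"] incseqD[OF incW, of l "Suc (max k l)"]
      by (simp_all del: UN_I)
    then show "tr f k x = 0" "tr g l x = 0"
      if "x \<notin> {exp (- real (Suc (max k l)))..exp (real (Suc (max k l)))}" for x
      using that unfolding tr_def W_def[of "Suc (max k l)"] by (auto simp: indicator_def)
    show "tr f k x * tr g l y \<le> exp (- (x * y))" if "x > 0" "y > 0" for x y
    proof -
      have "ennreal (tr f k x * tr g l y) \<le> f x * g y"
        using trb by (simp add: ennreal_mult mult_mono trle)
      also have "\<dots> \<le> ennreal (exp (- (x * y)))" by (rule dual[OF that])
      finally show ?thesis by (simp add: ennreal_le_iff)
    qed
    show "tr f k x \<le> real (max k l)" "tr g l x \<le> real (max k l)" for x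
      using trb(2)[of f k x] trb(2)[of g l x] by linarith+
  qed (use trb in auto)
  then have "(\<integral>\<^sup>+x. f x * indicator (\<Union>k. W k) x \<partial>lborel)
      * (\<integral>\<^sup>+x. min (g x) (of_nat l) * indicator (W l) x \<partial>lborel) \<le> ennreal (pi / 2)" for l
    by (intro nn_integral_truncation_mult_le[OF _ _ incW]) auto
  then have "(\<integral>\<^sup>+x. g x * indicator (\<Union>k. W k) x \<partial>lborel)
      * (\<integral>\<^sup>+x. f x * indicator (\<Union>k. W k) x \<partial>lborel) \<le> ennreal (pi / 2)"
    by (intro nn_integral_truncation_mult_le[OF _ _ incW]) (auto simp: mult.commute)
  then show ?thesis by (simp add: UW mult.commute)
qed

text \<open>Keeping the half-line of \<open>g\<close> closed lets two opposite ones cover the whole line.\<close>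

lemma signed_half_line_santalo:
  fixes f g :: "real \<Rightarrow> ennreal" and e c :: real
  assumes [measurable]: "f \<in> borel_measurable borel" "g \<in> borel_measurable borel"
    and e: "\<bar>e\<bar> = 1" and c: "c > 0"
    and dual: "\<And>x y. f x * g y \<le> ennreal (c * exp (- (x * y)))"
  shows "(\<integral>\<^sup>+x. f x * indicator {x. e * x > 0} x \<partial>lborel)
    * (\<integral>\<^sup>+y. g y * indicator {y. e * y \<ge> 0} y \<partial>lborel) \<le> ennreal (c * (pi / 2))"
proof -
  have e2: "e * (e * x) = x" for x using e by (auto simp: abs_if split: if_splits)
  have flip: "(\<integral>\<^sup>+x. h x \<partial>lborel) = (\<integral>\<^sup>+x. h (e * x) \<partial>lborel)"
    if [measurable]: "h \<in> borel_measurable borel" for h :: "real \<Rightarrow> ennreal"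
    using e by (subst nn_integral_real_affine[where c = e and t = 0]) (auto)
  have F: "(\<integral>\<^sup>+x. f x * indicator {x. e * x > 0} x \<partial>lborel)
      = (\<integral>\<^sup>+x. f (e * x) * indicator {0<..} x \<partial>lborel)"
    by (subst flip) (auto simp: e2 indicator_def intro!: nn_integral_cong)
  have "(\<integral>\<^sup>+x. g x * indicator {x. e * x \<ge> 0} x \<partial>lborel)
      = (\<integral>\<^sup>+x. g (e * x) * indicator {0..} x \<partial>lborel)"
    by (subst flip) (auto simp: e2 indicator_def intro!: nn_integral_cong)
  also have "\<dots> = (\<integral>\<^sup>+x. g (e * x) * indicator {0<..} x \<partial>lborel)"
    using AE_lborel_singleton[of "0::real"]
    by (intro nn_integral_cong_AE) (auto simp: indicator_def elim!: eventually_mono)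
  finally have G: "(\<integral>\<^sup>+x. g x * indicator {x. e * x \<ge> 0} x \<partial>lborel)
      = (\<integral>\<^sup>+x. g (e * x) * indicator {0<..} x \<partial>lborel)" .
  have ci: "ennreal (1 / c) * ennreal c = 1"
    using c by (simp add: ennreal_mult'[symmetric])
  \<comment> \<open>Dividing \<open>g\<close> by \<open>c\<close> normalises the duality relation;
    reflecting both variables by the same sign \<open>e\<close> leaves the product
    \<open>x * y\<close> unchanged.\<close>
  have "(\<integral>\<^sup>+x. f (e * x) * indicator {0<..} x \<partial>lborel)
      * (\<integral>\<^sup>+x. (ennreal (1 / c) * g (e * x)) * indicator {0<..} x \<partial>lborel) \<le> ennreal (pi / 2)"
  proof (rule half_line_santalo)
    fix x y :: real
    have "f (e * x) * (ennreal (1 / c) * g (e * y)) = ennreal (1 / c) * (f (e * x) * g (e * y))"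
      by (simp add: ac_simps)
    also have "\<dots> \<le> ennreal (1 / c) * ennreal (c * exp (- (e * x * (e * y))))"
      by (intro mult_left_mono dual) auto
    also have "\<dots> = ennreal (exp (- (x * y)))"
      using c e2[of "x * y"] by (simp add: ennreal_mult'[symmetric] ac_simps)
    finally show "f (e * x) * (ennreal (1 / c) * g (e * y)) \<le> ennreal (exp (- (x * y)))" .
  qed measurable
  also have "(\<integral>\<^sup>+x. (ennreal (1 / c) * g (e * x)) * indicator {0<..} x \<partial>lborel)
      = ennreal (1 / c) * (\<integral>\<^sup>+x. g (e * x) * indicator {0<..} x \<partial>lborel)"
    by (simp add: mult.assoc nn_integral_cmult)
  finally have "ennreal c * ((\<integral>\<^sup>+x. f (e * x) * indicator {0<..} x \<partial>lborel)
      * (ennreal (1 / c) * (\<integral>\<^sup>+x. g (e * x) * indicator {0<..} x \<partial>lborel))) \<le> ennreal c * ennreal (pi / 2)"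
    by (rule mult_left_mono) auto
  also have "ennreal c * ennreal (pi / 2) = ennreal (c * (pi / 2))"
    using c ennreal_mult'[of c "pi / 2"] by simp
  also have "ennreal c * ((\<integral>\<^sup>+x. f (e * x) * indicator {0<..} x \<partial>lborel)
      * (ennreal (1 / c) * (\<integral>\<^sup>+x. g (e * x) * indicator {0<..} x \<partial>lborel)))
    = (ennreal (1 / c) * ennreal c) * ((\<integral>\<^sup>+x. f (e * x) * indicator {0<..} x \<partial>lborel)
      * (\<integral>\<^sup>+x. g (e * x) * indicator {0<..} x \<partial>lborel))"
    by (simp only: ac_simps)
  finally show ?thesis unfolding ci F G by simp
qed

section \<open>Lebesgue measure on coordinate spaces, translations and shears\<close>

text \<open>Coordinates are indexed by a set and not by a type, so that the dimension can grow by
  \<open>insert\<close> within an induction.\<close>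

abbreviation lborel_PiM :: "'i set \<Rightarrow> ('i \<Rightarrow> real) measure" where
  "lborel_PiM I \<equiv> PiM I (\<lambda>_. lborel)"

lemma product_sigma_finite_lborel: "product_sigma_finite (\<lambda>_::'i. lborel :: real measure)"
  by unfold_locales

lemma sigma_finite_lborel_PiM: "finite I \<Longrightarrow> sigma_finite_measure (lborel_PiM I)"
  by (rule product_sigma_finite.sigma_finite[OF product_sigma_finite_lborel])

lemma pair_sigma_finite_lborel_PiM: "finite I \<Longrightarrow> pair_sigma_finite (lborel_PiM I) (lborel :: real measure)"
  by (intro pair_sigma_finite.intro sigma_finite_lborel_PiM lborel.sigma_finite_measure_axioms)

lemmas nn_integral_PiM_insert = product_sigma_finite.product_nn_integral_insert[OF product_sigma_finite_lborel]
lemmas nn_integral_PiM_insert_rev = product_sigma_finite.product_nn_integral_insert_rev[OF product_sigma_finite_lborel]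

lemma borel_measurable_PiM_section:
  assumes "finite I" and f: "f \<in> borel_measurable (lborel_PiM (insert i I))"
  shows "(\<lambda>(x, t). f (x(i := t))) \<in> borel_measurable (lborel_PiM I \<Otimes>\<^sub>M lborel)"
  using measurable_compose[OF measurable_add_dim f] by (simp add: case_prod_beta')

lemma nn_integral_lborel_shift:
  fixes f :: "real \<Rightarrow> ennreal"
  assumes [measurable]: "f \<in> borel_measurable borel"
  shows "(\<integral>\<^sup>+x. f (c + x) \<partial>lborel) = (\<integral>\<^sup>+x. f x \<partial>lborel)"
  using nn_integral_real_affine[of f 1 c] by simp

lemma nn_integral_PiM_translate:
  assumes "finite I" "f \<in> borel_measurable (lborel_PiM I)"
  shows "(\<integral>\<^sup>+x. f (\<lambda>i\<in>I. c i + x i) \<partial>lborel_PiM I) = (\<integral>\<^sup>+x. f x \<partial>lborel_PiM I)"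
  using assms
proof (induction I arbitrary: f rule: finite_induct)
  case empty
  show ?case by (intro nn_integral_cong) (auto simp: space_PiM)
next
  case (insert i I)
  note [measurable] = insert.prems
  interpret sigma_finite_measure "lborel_PiM I" using insert sigma_finite_lborel_PiM by blast
  have sec[measurable]: "(\<lambda>(x, t). f (x(i := t))) \<in> borel_measurable (lborel_PiM I \<Otimes>\<^sub>M lborel)"
    using insert by (intro borel_measurable_PiM_section)
  have [measurable]: "(\<lambda>x. \<integral>\<^sup>+t. f (x(i := t)) \<partial>lborel) \<in> borel_measurable (lborel_PiM I)"
    by (rule lborel.borel_measurable_nn_integral[OF sec])
  have sec1: "(\<lambda>t. f (x(i := t))) \<in> borel_measurable borel" if "x \<in> space (lborel_PiM I)" for x
    using measurable_Pair2[OF sec that] by (simp add: o_def)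
  have sp: "(\<lambda>k\<in>I. c k + x k) \<in> space (lborel_PiM I)" for x
    by (simp add: space_PiM)
  have "(\<integral>\<^sup>+x. f (\<lambda>k\<in>insert i I. c k + x k) \<partial>lborel_PiM (insert i I))
      = (\<integral>\<^sup>+x. \<integral>\<^sup>+t. f (\<lambda>k\<in>insert i I. c k + (x(i := t)) k) \<partial>lborel \<partial>lborel_PiM I)"
    using insert.hyps by (intro nn_integral_PiM_insert) measurable
  also have "\<dots> = (\<integral>\<^sup>+x. \<integral>\<^sup>+t. f ((\<lambda>k\<in>I. c k + x k)(i := c i + t)) \<partial>lborel \<partial>lborel_PiM I)"
    using insert.hyps by (intro nn_integral_cong arg_cong[where f = f]) (auto simp: fun_eq_iff)
  also have "\<dots> = (\<integral>\<^sup>+x. \<integral>\<^sup>+t. f ((\<lambda>k\<in>I. c k + x k)(i := t)) \<partial>lborel \<partial>lborel_PiM I)"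
    by (intro nn_integral_cong nn_integral_lborel_shift sec1 sp)
  also have "\<dots> = (\<integral>\<^sup>+x. \<integral>\<^sup>+t. f (x(i := t)) \<partial>lborel \<partial>lborel_PiM I)"
    by (rule insert.IH) measurable
  also have "\<dots> = (\<integral>\<^sup>+x. f x \<partial>lborel_PiM (insert i I))"
    using insert.hyps by (intro nn_integral_PiM_insert[symmetric]) measurable
  finally show ?case .
qed

text \<open>In coordinates centred at \<open>z\<close>, \<open>shear\<close> is the linear map fixing the hyperplane of \<open>I\<close> and sending
  the basis vector of \<open>j\<close> to itself plus \<open>u\<close>; \<open>dual_shear\<close> is its inverse transpose, so that
  together they preserve the pairing. Both have determinant \<open>1\<close>.\<close>

definition shear :: "'i set \<Rightarrow> 'i \<Rightarrow> ('i \<Rightarrow> real) \<Rightarrow> ('i \<Rightarrow> real) \<Rightarrow> ('i \<Rightarrow> real) \<Rightarrow> real \<Rightarrow> 'i \<Rightarrow> real" where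
  "shear I j z u y s = (\<lambda>i\<in>insert j I. if i = j then z j + s else (z i + s * u i) + y i)"

definition dual_shear :: "'i set \<Rightarrow> 'i \<Rightarrow> ('i \<Rightarrow> real) \<Rightarrow> ('i \<Rightarrow> real) \<Rightarrow> real \<Rightarrow> 'i \<Rightarrow> real" where
  "dual_shear I j u y t = (\<lambda>i\<in>insert j I. if i = j then - (\<Sum>k\<in>I. u k * y k) + t else y i)"

lemma shear_in_space: "shear I j z u y s \<in> space (lborel_PiM (insert j I))"
  "dual_shear I j u y t \<in> space (lborel_PiM (insert j I))"
  by (simp_all add: shear_def dual_shear_def space_PiM)

lemma measurable_shear [measurable]:
  assumes "finite I"
  shows "(\<lambda>(y, s). shear I j z u y s) \<in> lborel_PiM I \<Otimes>\<^sub>M lborel \<rightarrow>\<^sub>M lborel_PiM (insert j I)"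
    and "(\<lambda>(y, t). dual_shear I j u y t) \<in> lborel_PiM I \<Otimes>\<^sub>M lborel \<rightarrow>\<^sub>M lborel_PiM (insert j I)"
proof -
  have comp: "(\<lambda>p. fst p i) \<in> borel_measurable (lborel_PiM I \<Otimes>\<^sub>M lborel)" if "i \<in> I" for i :: 'a
    using measurable_compose[OF measurable_fst
        measurable_component_singleton[OF that, of "\<lambda>_. lborel :: real measure"]] by simp
  show "(\<lambda>(y, s). shear I j z u y s) \<in> lborel_PiM I \<Otimes>\<^sub>M lborel \<rightarrow>\<^sub>M lborel_PiM (insert j I)"
    unfolding shear_def case_prod_beta'
  proof (rule measurable_restrict)
    fix i assume "i \<in> insert j I"
    then show "(\<lambda>p. if i = j then z j + snd p else z i + snd p * u i + fst p i)
        \<in> lborel_PiM I \<Otimes>\<^sub>M lborel \<rightarrow>\<^sub>M lborel"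
      using comp[of i] by (cases "i = j") simp_all
  qed
  show "(\<lambda>(y, t). dual_shear I j u y t) \<in> lborel_PiM I \<Otimes>\<^sub>M lborel \<rightarrow>\<^sub>M lborel_PiM (insert j I)"
    unfolding dual_shear_def case_prod_beta'
  proof (rule measurable_restrict)
    fix i assume i: "i \<in> insert j I"
    have "(\<lambda>p. \<Sum>k\<in>I. u k * fst p k) \<in> borel_measurable (lborel_PiM I \<Otimes>\<^sub>M lborel)"
      using comp by (intro borel_measurable_sum borel_measurable_times) auto
    then show "(\<lambda>p. if i = j then - (\<Sum>k\<in>I. u k * fst p k) + snd p else fst p i)
        \<in> lborel_PiM I \<Otimes>\<^sub>M lborel \<rightarrow>\<^sub>M lborel"
      using comp[of i] i by (cases "i = j") simp_all
  qed
qed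

text \<open>Only Fubini and translation invariance are used. For fixed \<open>s\<close> the shear
  translates the coordinates in \<open>I\<close>, after a translation of coordinate \<open>j\<close>
  by \<open>z j\<close>; for fixed \<open>y\<close> the dual shear translates coordinate
  \<open>j\<close> alone.\<close>

lemma nn_integral_shear:
  assumes I: "finite I" "j \<notin> I" and h[measurable]: "h \<in> borel_measurable (lborel_PiM (insert j I))"
  shows "(\<integral>\<^sup>+x. h x \<partial>lborel_PiM (insert j I))
      = (\<integral>\<^sup>+y. \<integral>\<^sup>+s. h (shear I j z u y s) \<partial>lborel \<partial>lborel_PiM I)" (is ?th1)
    and "(\<integral>\<^sup>+x. h x \<partial>lborel_PiM (insert j I))
      = (\<integral>\<^sup>+y. \<integral>\<^sup>+t. h (dual_shear I j u y t) \<partial>lborel \<partial>lborel_PiM I)" (is ?th2)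
proof -
  interpret P: pair_sigma_finite "lborel_PiM I" "lborel :: real measure"
    by (rule pair_sigma_finite_lborel_PiM) fact
  have sec: "(\<lambda>(x, t). h (x(j := t))) \<in> borel_measurable (lborel_PiM I \<Otimes>\<^sub>M lborel)"
    by (rule borel_measurable_PiM_section) fact+
  have sec1: "(\<lambda>t. h (x(j := t))) \<in> borel_measurable borel" if "x \<in> space (lborel_PiM I)" for x
    using measurable_Pair2[OF sec that] by (simp add: o_def)
  have sec2: "(\<lambda>x. h (x(j := t))) \<in> borel_measurable (lborel_PiM I)" for t
    using measurable_Pair1[OF sec, of t] by (simp add: o_def)
  have inner: "(\<lambda>t. \<integral>\<^sup>+x. h (x(j := t)) \<partial>lborel_PiM I) \<in> borel_measurable borel"
    using P.M1.borel_measurable_nn_integral[of "\<lambda>t x. h (x(j := t))" lborel]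
      measurable_pair_swap[OF sec] by (simp add: case_prod_beta')
  have "(\<integral>\<^sup>+x. h x \<partial>lborel_PiM (insert j I)) = (\<integral>\<^sup>+t. \<integral>\<^sup>+x. h (x(j := t)) \<partial>lborel_PiM I \<partial>lborel)"
    using I by (intro nn_integral_PiM_insert_rev) measurable
  also have "\<dots> = (\<integral>\<^sup>+s. \<integral>\<^sup>+x. h (x(j := z j + s)) \<partial>lborel_PiM I \<partial>lborel)"
    by (rule nn_integral_lborel_shift[symmetric]) (rule inner)
  also have "\<dots> = (\<integral>\<^sup>+s. \<integral>\<^sup>+x. h ((\<lambda>i\<in>I. (z i + s * u i) + x i)(j := z j + s)) \<partial>lborel_PiM I \<partial>lborel)"
    using I by (intro nn_integral_cong nn_integral_PiM_translate[symmetric] sec2)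
  also have "\<dots> = (\<integral>\<^sup>+s. \<integral>\<^sup>+y. h (shear I j z u y s) \<partial>lborel_PiM I \<partial>lborel)"
    using I by (intro nn_integral_cong arg_cong[where f = h]) (auto simp: shear_def fun_eq_iff)
  also have "\<dots> = (\<integral>\<^sup>+y. \<integral>\<^sup>+s. h (shear I j z u y s) \<partial>lborel \<partial>lborel_PiM I)"
    using measurable_compose[OF measurable_shear(1)[OF I(1)] h]
    by (intro P.Fubini') (simp add: case_prod_beta')
  finally show ?th1 .
  have "(\<integral>\<^sup>+x. h x \<partial>lborel_PiM (insert j I)) = (\<integral>\<^sup>+x. \<integral>\<^sup>+t. h (x(j := t)) \<partial>lborel \<partial>lborel_PiM I)"
    using I by (intro nn_integral_PiM_insert) measurable
  also have "\<dots> = (\<integral>\<^sup>+x. \<integral>\<^sup>+t. h (x(j := - (\<Sum>k\<in>I. u k * x k) + t)) \<partial>lborel \<partial>lborel_PiM I)"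
    by (intro nn_integral_cong nn_integral_lborel_shift[symmetric] sec1)
  also have "\<dots> = (\<integral>\<^sup>+y. \<integral>\<^sup>+t. h (dual_shear I j u y t) \<partial>lborel \<partial>lborel_PiM I)"
  proof (intro nn_integral_cong arg_cong[where f = h])
    fix y t assume "y \<in> space (lborel_PiM I)"
    then show "y(j := - (\<Sum>k\<in>I. u k * y k) + t) = dual_shear I j u y t"
      using I by (auto simp: dual_shear_def fun_eq_iff space_PiM PiE_def extensional_def)
  qed
  finally show ?th2 .
qed

text \<open>The cross terms \<open>s * u i * y' i\<close> cancel against the sum in coordinate
  \<open>j\<close> of the dual shear. Hence, for fixed \<open>y\<close> and \<open>y'\<close>,
  duality in all coordinates becomes a one-dimensional duality in \<open>s\<close> and
  \<open>t\<close> with a constant factor.\<close>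

lemma shear_pairing:
  assumes "finite I" "j \<notin> I"
  shows "(\<Sum>i\<in>insert j I. (shear I j z u y s i - z i) * dual_shear I j u y' t i)
    = (\<Sum>i\<in>I. y i * y' i) + s * t"
proof -
  have "(\<Sum>i\<in>I. (shear I j z u y s i - z i) * dual_shear I j u y' t i)
      = (\<Sum>i\<in>I. s * (u i * y' i) + y i * y' i)"
    using assms by (intro sum.cong) (auto simp: shear_def dual_shear_def algebra_simps)
  then show ?thesis
    using assms by (simp add: shear_def dual_shear_def sum.distrib sum_distrib_left[symmetric] algebra_simps)
qed

section \<open>Induction statement and the inequality for a pair of half-spaces\<close>

text \<open>The values are extended reals because integrating out a coordinate may produce \<open>\<infinity>\<close>.\<close>

definition santalo_on :: "'i set \<Rightarrow> bool" where
  "santalo_on I \<longleftrightarrow> (\<forall>f \<in> borel_measurable (lborel_PiM I). \<forall>g \<in> borel_measurable (lborel_PiM I).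
     (\<integral>\<^sup>+x. f x \<partial>lborel_PiM I) < \<infinity> \<longrightarrow>
     (\<forall>i\<in>I. integrable (density (lborel_PiM I) f) (\<lambda>x. x i) \<and> (\<integral>x. x i \<partial>density (lborel_PiM I) f) = 0) \<longrightarrow>
     (\<forall>x \<in> space (lborel_PiM I). \<forall>y \<in> space (lborel_PiM I).
        f x * g y \<le> ennreal (exp (- (\<Sum>i\<in>I. x i * y i)))) \<longrightarrow>
     (\<integral>\<^sup>+x. f x \<partial>lborel_PiM I) * (\<integral>\<^sup>+y. g y \<partial>lborel_PiM I) \<le> ennreal ((2 * pi) ^ card I))"

text \<open>Let \<open>F\<close> and \<open>G\<close> be the integrals of \<open>f\<close> and
  \<open>g\<close> over the half-fibres of the shear and of its dual. On each pair of fibres the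
  half-line inequality applies with constant \<open>exp (- (\<Sum>i\<in>I. y i * y' i))\<close>, so
  \<open>F\<close> and \<open>2 / pi\<close> times \<open>G\<close> are dual on the hyperplane. The
  hypotheses on \<open>N\<close> say that projecting the half of \<open>f\<close> along the
  direction \<open>(u, 1)\<close> gives barycenter \<open>z\<close>, which is the origin in the
  coordinates of \<open>F\<close>; this is what the induction hypothesis asks for.\<close>

lemma half_space_santalo:
  fixes f g :: "('i \<Rightarrow> real) \<Rightarrow> ennreal" and e :: real
  assumes I: "finite I" "j \<notin> I" and IH: "santalo_on I"
    and f[measurable]: "f \<in> borel_measurable (lborel_PiM (insert j I))"
    and g[measurable]: "g \<in> borel_measurable (lborel_PiM (insert j I))"
    and e: "\<bar>e\<bar> = 1"
    and fin: "(\<integral>\<^sup>+x. f x \<partial>lborel_PiM (insert j I)) < \<infinity>"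
    and N_def: "N = density (lborel_PiM (insert j I)) (\<lambda>x. f x * indicator {x. e * (x j - z j) > 0} x)"
    and bar: "\<And>i. i \<in> I \<Longrightarrow> integrable N (\<lambda>x. x i - z i - (x j - z j) * u i)"
      "\<And>i. i \<in> I \<Longrightarrow> (\<integral>x. x i - z i - (x j - z j) * u i \<partial>N) = 0"
    and dual: "\<And>x y. x \<in> space (lborel_PiM (insert j I)) \<Longrightarrow> y \<in> space (lborel_PiM (insert j I)) \<Longrightarrow>
      f x * g y \<le> ennreal (exp (- (\<Sum>i\<in>insert j I. (x i - z i) * y i)))"
  shows "(\<integral>\<^sup>+x. f x * indicator {x. e * (x j - z j) > 0} x \<partial>lborel_PiM (insert j I))
    * (\<integral>\<^sup>+y. g y * indicator {y. e * (y j + (\<Sum>i\<in>I. u i * y i)) \<ge> 0} y \<partial>lborel_PiM (insert j I))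
    \<le> ennreal (pi / 2 * (2 * pi) ^ card I)"
proof -
  let ?P = "lborel_PiM I" and ?P' = "lborel_PiM (insert j I)"
  define F where "F y = (\<integral>\<^sup>+s. f (shear I j z u y s) * indicator {s. e * s > 0} s \<partial>lborel)" for y
  define G where "G y = (\<integral>\<^sup>+t. g (dual_shear I j u y t) * indicator {t. e * t \<ge> 0} t \<partial>lborel)" for y
  \<comment> \<open>Projection onto the hyperplane along \<open>(u, 1)\<close>, in coordinates
    centred at \<open>z\<close>; it recovers \<open>y\<close> from the shear and forgets
    \<open>s\<close>.\<close>
  define T where "T x = (\<lambda>i\<in>I. x i - z i - (x j - z j) * u i)" for x
  have comp[measurable]: "(\<lambda>x. x i) \<in> borel_measurable ?P'" if "i \<in> insert j I" for i
    using measurable_component_singleton[OF that, of "\<lambda>_. lborel :: real measure"] by simp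
  have jm[measurable]: "(\<lambda>x. x j) \<in> borel_measurable ?P'" by (rule comp) simp
  have sm[measurable]: "(\<lambda>y. \<Sum>i\<in>I. u i * y i) \<in> borel_measurable ?P'"
    using comp by (intro borel_measurable_sum borel_measurable_times) auto
  have T[measurable]: "T \<in> ?P' \<rightarrow>\<^sub>M ?P"
    unfolding T_def[abs_def]
    by (rule measurable_restrict) (simp add: comp)
  have fs: "(\<lambda>(y, s). f (shear I j z u y s)) \<in> borel_measurable (?P \<Otimes>\<^sub>M lborel)"
    using measurable_compose[OF measurable_shear(1)[OF I(1)] f] by (simp add: case_prod_beta')
  have gs: "(\<lambda>(y, s). g (dual_shear I j u y s)) \<in> borel_measurable (?P \<Otimes>\<^sub>M lborel)"
    using measurable_compose[OF measurable_shear(2)[OF I(1)] g] by (simp add: case_prod_beta')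
  have F[measurable]: "F \<in> borel_measurable ?P"
    unfolding F_def[abs_def] using fs
    by (intro lborel.borel_measurable_nn_integral) (simp add: case_prod_beta')
  have G[measurable]: "G \<in> borel_measurable ?P"
    unfolding G_def[abs_def] using gs
    by (intro lborel.borel_measurable_nn_integral) (simp add: case_prod_beta')
  have fs1: "(\<lambda>s. f (shear I j z u y s)) \<in> borel_measurable borel" if "y \<in> space ?P" for y
    using measurable_Pair2[OF fs that] by (simp add: o_def)
  have gs1: "(\<lambda>s. g (dual_shear I j u y s)) \<in> borel_measurable borel" if "y \<in> space ?P" for y
    using measurable_Pair2[OF gs that] by (simp add: o_def)
  have shear_j: "shear I j z u y s j - z j = s" for y s by (simp add: shear_def)
  have dshear_j: "dual_shear I j u y t j + (\<Sum>i\<in>I. u i * dual_shear I j u y t i) = t" for y t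
  proof -
    have "(\<Sum>i\<in>I. u i * dual_shear I j u y t i) = (\<Sum>i\<in>I. u i * y i)"
      using I by (intro sum.cong) (auto simp: dual_shear_def)
    then show ?thesis by (simp add: dual_shear_def)
  qed
  have T_shear: "T (shear I j z u y s) = y" if "y \<in> space ?P" for y s
    using that I by (auto simp: T_def shear_def fun_eq_iff space_PiM PiE_def extensional_def)
  have intF: "(\<integral>\<^sup>+x. f x * indicator {x. e * (x j - z j) > 0} x \<partial>?P') = (\<integral>\<^sup>+y. F y \<partial>?P)"
    by (subst nn_integral_shear(1)[OF I, of _ z u])
      (auto simp: F_def indicator_def shear_j intro!: nn_integral_cong)
  have intG: "(\<integral>\<^sup>+y. g y * indicator {y. e * (y j + (\<Sum>i\<in>I. u i * y i)) \<ge> 0} y \<partial>?P') = (\<integral>\<^sup>+y. G y \<partial>?P)"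
    by (subst nn_integral_shear(2)[OF I, of _ u])
      (auto simp: G_def indicator_def dshear_j intro!: nn_integral_cong)
  \<comment> \<open>\<open>F\<close> is the density of the image of \<open>N\<close> under
    \<open>T\<close>, which carries the barycenter hypotheses over to \<open>F\<close>.\<close>
  have dens: "density ?P F = distr N ?P T"
  proof (rule measure_eqI)
    fix A assume "A \<in> sets (density ?P F)"
    then have A[measurable]: "A \<in> sets ?P" by simp
    have [measurable]: "T \<in> N \<rightarrow>\<^sub>M ?P" by (simp add: N_def)
    have TA[measurable]: "T -` A \<inter> space ?P' \<in> sets ?P'" by measurable
    have "emeasure (distr N ?P T) A = emeasure N (T -` A \<inter> space ?P')"
      by (subst emeasure_distr) (simp_all add: N_def)
    also have "\<dots> = (\<integral>\<^sup>+x. f x * indicator {x. e * (x j - z j) > 0} x * indicator (T -` A \<inter> space ?P') x \<partial>?P')"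
      unfolding N_def by (subst emeasure_density) simp_all
    also have "\<dots> = (\<integral>\<^sup>+y. \<integral>\<^sup>+s. f (shear I j z u y s) * indicator {s. e * s > 0} s * indicator A y \<partial>lborel \<partial>?P)"
      by (subst nn_integral_shear(1)[OF I, of _ z u])
        (auto simp: indicator_def shear_j T_shear shear_in_space intro!: nn_integral_cong)
    also have "\<dots> = (\<integral>\<^sup>+y. F y * indicator A y \<partial>?P)"
      unfolding F_def using fs1
      by (intro nn_integral_cong nn_integral_multc) simp
    also have "\<dots> = emeasure (density ?P F) A" by (subst emeasure_density) simp_all
    finally show "emeasure (density ?P F) A = emeasure (distr N ?P T) A" ..
  qed simp
  have T': "T \<in> N \<rightarrow>\<^sub>M ?P" by (simp add: N_def)
  have pc: "(\<lambda>x. x i) \<in> borel_measurable ?P" if "i \<in> I" for i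
    using measurable_component_singleton[OF that, of "\<lambda>_. lborel :: real measure"] by simp
  have barF: "integrable (density ?P F) (\<lambda>x. x i)" "(\<integral>x. x i \<partial>density ?P F) = 0" if i: "i \<in> I" for i
    unfolding dens using bar i pc[OF i]
    by (simp_all add: integrable_distr_eq[OF T'] integral_distr[OF T'] T_def)
  have finF: "(\<integral>\<^sup>+y. F y \<partial>?P) < \<infinity>"
    unfolding intF[symmetric] using fin
    by (rule le_less_trans[rotated]) (auto intro!: nn_integral_mono simp: indicator_def)
  \<comment> \<open>The factor \<open>2 / pi\<close> cancels the half-line constant; it returns as
    \<open>pi / 2\<close> after the induction hypothesis has been applied.\<close>
  have FG: "F y * (ennreal (2 / pi) * G y') \<le> ennreal (exp (- (\<Sum>i\<in>I. y i * y' i)))"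
    if y: "y \<in> space ?P" "y' \<in> space ?P" for y y'
  proof -
    define c where "c = exp (- (\<Sum>i\<in>I. y i * y' i))"
    have "F y * G y' \<le> ennreal (c * (pi / 2))"
      unfolding F_def G_def
    proof (rule signed_half_line_santalo[OF fs1[OF y(1)] gs1[OF y(2)] e])
      fix s t
      have "f (shear I j z u y s) * g (dual_shear I j u y' t) \<le> ennreal (exp (- ((\<Sum>i\<in>I. y i * y' i) + s * t)))"
        using dual[OF shear_in_space, of z u y s u y' t] unfolding shear_pairing[OF I] .
      then show "f (shear I j z u y s) * g (dual_shear I j u y' t) \<le> ennreal (c * exp (- (s * t)))"
        by (simp add: c_def exp_add[symmetric])
    qed (simp add: c_def)
    then have "ennreal (2 / pi) * (F y * G y') \<le> ennreal (2 / pi) * ennreal (c * (pi / 2))"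
      by (rule mult_left_mono) simp
    also have "\<dots> = ennreal ((2 / pi) * (c * (pi / 2)))"
      by (rule ennreal_mult'[symmetric]) simp
    also have "(2 / pi) * (c * (pi / 2)) = c" by simp
    finally show ?thesis by (simp add: c_def mult.left_commute)
  qed
  have "(\<integral>\<^sup>+y. F y \<partial>?P) * (\<integral>\<^sup>+y. ennreal (2 / pi) * G y \<partial>?P) \<le> ennreal ((2 * pi) ^ card I)"
    using IH F G finF barF FG unfolding santalo_on_def
    by (auto elim!: ballE[of _ _ F] ballE[of _ _ "\<lambda>y. ennreal (2 / pi) * G y"])
  then have "ennreal (pi / 2) * ((\<integral>\<^sup>+y. F y \<partial>?P) * (ennreal (2 / pi) * (\<integral>\<^sup>+y. G y \<partial>?P)))
      \<le> ennreal (pi / 2) * ennreal ((2 * pi) ^ card I)"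
    by (intro mult_left_mono) (simp_all add: nn_integral_cmult)
  also have "\<dots> = ennreal (pi / 2 * (2 * pi) ^ card I)"
    by (rule ennreal_mult'[symmetric]) simp
  also have "ennreal (pi / 2) * ((\<integral>\<^sup>+y. F y \<partial>?P) * (ennreal (2 / pi) * (\<integral>\<^sup>+y. G y \<partial>?P)))
      = (ennreal (pi / 2) * ennreal (2 / pi)) * ((\<integral>\<^sup>+y. F y \<partial>?P) * (\<integral>\<^sup>+y. G y \<partial>?P))"
    by (simp only: ac_simps)
  also have "ennreal (pi / 2) * ennreal (2 / pi) = 1"
    by (simp add: ennreal_mult'[symmetric])
  finally show ?thesis unfolding intF intG by simp
qed

section \<open>Cutting by a median hyperplane\<close>

lemma PiM_hyperplane_null:
  assumes I: "finite I" "j \<notin> I" and f[measurable]: "f \<in> borel_measurable (lborel_PiM (insert j I))"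
  shows "(\<integral>\<^sup>+x. f x * indicator {x. x j = m} x \<partial>lborel_PiM (insert j I)) = 0"
proof -
  have [measurable]: "(\<lambda>x. x j) \<in> borel_measurable (lborel_PiM (insert j I))"
    using measurable_component_singleton[of j "insert j I" "\<lambda>_. lborel :: real measure"] by simp
  have "(\<integral>\<^sup>+x. f x * indicator {x. x j = m} x \<partial>lborel_PiM (insert j I))
      = (\<integral>\<^sup>+x. \<integral>\<^sup>+t. f (x(j := t)) * indicator {x. x j = m} (x(j := t)) \<partial>lborel \<partial>lborel_PiM I)"
    using I by (intro nn_integral_PiM_insert) measurable
  also have "\<dots> = (\<integral>\<^sup>+x. \<integral>\<^sup>+t. 0 \<partial>(lborel :: real measure) \<partial>lborel_PiM I)"
  proof (rule nn_integral_cong, rule nn_integral_cong_AE)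
    fix x
    show "AE t in lborel. f (x(j := t)) * indicator {x. x j = m} (x(j := t)) = 0"
      using AE_lborel_singleton[of m] by (auto elim!: eventually_mono simp: indicator_def)
  qed
  finally show ?thesis by simp
qed

text \<open>Hyperplanes are null, so the distribution of coordinate \<open>j\<close> under the
  density \<open>f\<close> has no atoms. Its distribution function is therefore continuous, takes
  the value \<open>M / 2\<close>, and the hyperplane takes no mass from either open side. The sign
  \<open>e\<close> treats both sides at once.\<close>

lemma median_hyperplane:
  fixes M :: real
  assumes I: "finite I" "j \<notin> I" and f[measurable]: "f \<in> borel_measurable (lborel_PiM (insert j I))"
    and M: "(\<integral>\<^sup>+x. f x \<partial>lborel_PiM (insert j I)) = ennreal M" "M > 0"
  obtains m where "\<And>e. e \<in> {1, -1} \<Longrightarrow>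
    (\<integral>\<^sup>+x. f x * indicator {x. e * (x j - m) > 0} x \<partial>lborel_PiM (insert j I)) = ennreal (M / 2)"
proof -
  let ?P = "lborel_PiM (insert j I)"
  define N where "N = distr (density ?P f) borel (\<lambda>x. x j)"
  have jm[measurable]: "(\<lambda>x. x j) \<in> borel_measurable ?P"
    using measurable_component_singleton[of j "insert j I" "\<lambda>_. lborel :: real measure"] by simp
  have emN: "emeasure N A = (\<integral>\<^sup>+x. f x * indicator {x. x j \<in> A} x \<partial>?P)" if [measurable]: "A \<in> sets borel" for A
  proof -
    have m: "(\<lambda>x. x j) \<in> density ?P f \<rightarrow>\<^sub>M borel" by simp
    have s: "(\<lambda>x. x j) -` A \<inter> space ?P \<in> sets ?P" by measurable
    have "emeasure N A = emeasure (density ?P f) ((\<lambda>x. x j) -` A \<inter> space ?P)"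
      unfolding N_def using m by (subst emeasure_distr) simp_all
    also have "\<dots> = (\<integral>\<^sup>+x. f x * indicator ((\<lambda>x. x j) -` A \<inter> space ?P) x \<partial>?P)"
      using s by (subst emeasure_density) simp_all
    also have "\<dots> = (\<integral>\<^sup>+x. f x * indicator {x. x j \<in> A} x \<partial>?P)"
      by (intro nn_integral_cong) (auto simp: indicator_def)
    finally show ?thesis .
  qed
  have N_UNIV: "emeasure N UNIV = ennreal M" using emN[of UNIV] M by simp
  interpret finite_borel_measure N
  proof (intro finite_borel_measure.intro finite_measureI finite_borel_measure_axioms.intro)
    show "emeasure N (space N) \<noteq> \<infinity>" using N_UNIV by (simp add: N_def)
    show "sets N = sets borel" by (simp add: N_def)
  qed
  have space_N: "space N = UNIV" by (simp add: N_def)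
  have mN: "measure N UNIV = M" using N_UNIV M by (simp add: measure_def)
  have atom: "emeasure N {t} = 0" for t
    using emN[of "{t}"] PiM_hyperplane_null[OF I f, of t] by simp
  have cont: "isCont (cdf N) t" for t
    using atom[of t] by (simp add: isCont_cdf measure_def)
  obtain a where a: "cdf N a < M / 2"
    using order_tendstoD(2)[OF cdf_lim_at_bot, of "M / 2"] M by (auto simp: eventually_at_bot_linorder)
  obtain b where b: "M / 2 < cdf N b"
    using order_tendstoD(1)[OF cdf_lim_at_top, of "M / 2"] M mN
    by (auto simp: eventually_at_top_linorder space_N)
  have "a \<le> b" using a b cdf_nondecreasing[of b a] by linarith
  then obtain m where m: "cdf N m = M / 2"
    using IVT[of "cdf N" a "M / 2" b] a b cont by auto
  have le: "emeasure N {..m} = ennreal (M / 2)"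
    using m by (simp only: cdf_def emeasure_eq_measure)
  have "{..m} = {..<m} \<union> {m}" by auto
  then have "emeasure N {..m} = emeasure N {..<m} + emeasure N {m}"
    by (simp only:) (rule plus_emeasure[symmetric], auto simp: N_def)
  then have lt: "emeasure N {..<m} = ennreal (M / 2)" using le atom by simp
  have [simp]: "{..m} \<in> sets N" by (simp add: N_def)
  have "measure N {m<..} = M / 2"
    using finite_measure_compl[of "{..m}"] m mN
    by (simp add: cdf_def space_N Compl_eq_Diff_UNIV[symmetric])
  then have gt: "emeasure N {m<..} = ennreal (M / 2)" by (simp only: emeasure_eq_measure)
  show ?thesis
  proof (rule that[of m])
    fix e :: real assume "e \<in> {1, -1}"
    then consider "e = 1" | "e = -1" by auto
    then show "(\<integral>\<^sup>+x. f x * indicator {x. e * (x j - m) > 0} x \<partial>?P) = ennreal (M / 2)"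
      by cases (use gt emN[of "{m<..}"] lt emN[of "{..<m}"] in simp_all)
  qed
qed

text \<open>The two half-space bounds share the same \<open>z\<close> and \<open>u\<close>, so they
  can be added. The point \<open>z\<close> is obtained before \<open>g\<close> is given: in the
  induction step the dual function is itself built from \<open>z\<close>.\<close>

lemma median_santalo:
  fixes f :: "('i \<Rightarrow> real) \<Rightarrow> ennreal" and M :: real
  assumes I: "finite I" "j \<notin> I" and IH: "santalo_on I"
    and f[measurable]: "f \<in> borel_measurable (lborel_PiM (insert j I))"
    and M: "(\<integral>\<^sup>+x. f x \<partial>lborel_PiM (insert j I)) = ennreal M" "M > 0"
    and int: "\<And>i. i \<in> insert j I \<Longrightarrow> integrable (density (lborel_PiM (insert j I)) f) (\<lambda>x. x i)"
  obtains z where "\<And>g. g \<in> borel_measurable (lborel_PiM (insert j I)) \<Longrightarrow>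
    (\<And>x y. x \<in> space (lborel_PiM (insert j I)) \<Longrightarrow> y \<in> space (lborel_PiM (insert j I)) \<Longrightarrow>
      f x * g y \<le> ennreal (exp (- (\<Sum>i\<in>insert j I. (x i - z i) * y i)))) \<Longrightarrow>
    (\<integral>\<^sup>+x. f x \<partial>lborel_PiM (insert j I)) * (\<integral>\<^sup>+y. g y \<partial>lborel_PiM (insert j I))
      \<le> ennreal ((2 * pi) ^ card (insert j I))"
proof -
  let ?P = "lborel_PiM (insert j I)"
  obtain m where m: "\<And>e. e \<in> {1, -1} \<Longrightarrow>
    (\<integral>\<^sup>+x. f x * indicator {x. e * (x j - m) > 0} x \<partial>?P) = ennreal (M / 2)"
    using median_hyperplane[OF I f M] by blast
  have comp[measurable]: "(\<lambda>x. x i) \<in> borel_measurable ?P" if "i \<in> insert j I" for i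
    using measurable_component_singleton[OF that, of "\<lambda>_. lborel :: real measure"] by simp
  have jm[measurable]: "(\<lambda>x. x j) \<in> borel_measurable ?P" by (rule comp) simp
  define N where "N e = density ?P (\<lambda>x. f x * indicator {x. e * (x j - m) > 0} x)" for e :: real
  \<comment> \<open>These moments are not normalised. Both halves have the same mass
    \<open>\<mu>\<close>, so this does not change the quotient \<open>u\<close> below, and
    \<open>z\<close> is divided by \<open>\<mu>\<close>.\<close>
  define \<beta> where "\<beta> e i = (\<integral>x. x i \<partial>N e)" for e i
  define \<mu> where "\<mu> = M / 2"
  have \<mu>: "\<mu> > 0" using M by (simp add: \<mu>_def)
  have spN: "space (N e) = space ?P" for e by (simp add: N_def)
  have emN: "emeasure (N e) (space ?P) = ennreal \<mu>" if "e \<in> {1, -1}" for e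
  proof -
    have "emeasure (N e) (space ?P) = (\<integral>\<^sup>+x. f x * indicator {x. e * (x j - m) > 0} x * indicator (space ?P) x \<partial>?P)"
      unfolding N_def by (subst emeasure_density) simp_all
    also have "\<dots> = (\<integral>\<^sup>+x. f x * indicator {x. e * (x j - m) > 0} x \<partial>?P)"
      by (intro nn_integral_cong) simp
    finally show ?thesis using m[OF that] by (simp add: \<mu>_def)
  qed
  have finN: "finite_measure (N e)" if "e \<in> {1, -1}" for e
    by (rule finite_measureI) (simp add: spN emN[OF that])
  have mN: "measure (N e) (space (N e)) = \<mu>" if "e \<in> {1, -1}" for e
    using emN[OF that] \<mu> by (simp add: spN measure_def)
  have intN: "integrable (N e) (\<lambda>x. x i)" if "i \<in> insert j I" for e i
  proof -
    have c[measurable]: "(\<lambda>x. x i) \<in> borel_measurable ?P" by (rule comp[OF that])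
    have "(\<integral>\<^sup>+x. ennreal (norm (x i)) \<partial>N e)
        = (\<integral>\<^sup>+x. f x * indicator {x. e * (x j - m) > 0} x * ennreal (norm (x i)) \<partial>?P)"
      unfolding N_def by (subst nn_integral_density) simp_all
    also have "\<dots> \<le> (\<integral>\<^sup>+x. f x * ennreal (norm (x i)) \<partial>?P)"
      by (intro nn_integral_mono) (auto simp: indicator_def)
    also have "\<dots> = (\<integral>\<^sup>+x. ennreal (norm (x i)) \<partial>density ?P f)"
      by (subst nn_integral_density) simp_all
    also have "\<dots> < \<infinity>" using int[OF that] by (simp add: integrable_iff_bounded)
    finally show ?thesis by (simp add: integrable_iff_bounded N_def)
  qed
  \<comment> \<open>A half of positive mass has its barycenter strictly on its own side. This makes
    the denominator of \<open>u\<close> positive.\<close>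
  have side: "e * (\<beta> e j - m * \<mu>) > 0" if e: "e \<in> {1, -1}" for e
  proof -
    interpret finite_measure "N e" by (rule finN[OF e])
    have int: "integrable (N e) (\<lambda>x. e * (x j - m))" using intN[of j e] by simp
    have "AE x in ?P. 0 < f x * indicator {x. e * (x j - m) > 0} x \<longrightarrow> e * (x j - m) > 0"
      by (auto simp: indicator_def)
    then have pos: "AE x in N e. e * (x j - m) > 0"
      unfolding N_def by (subst AE_density) simp_all
    have eq: "(\<integral>x. e * (x j - m) \<partial>N e) = e * (\<beta> e j - m * \<mu>)"
      using intN[of j e] mN[OF e] by (simp add: \<beta>_def)
    have "(\<integral>x. e * (x j - m) \<partial>N e) \<ge> 0"
      using pos by (intro integral_nonneg_AE) (auto elim: eventually_mono)
    moreover have "(\<integral>x. e * (x j - m) \<partial>N e) \<noteq> 0"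
    proof
      assume "(\<integral>x. e * (x j - m) \<partial>N e) = 0"
      then have "AE x in N e. e * (x j - m) = 0"
        by (subst (asm) integral_nonneg_eq_0_iff_AE[OF int])
          (use pos in \<open>auto elim: eventually_mono\<close>)
      with pos have "AE x in N e. False" by eventually_elim simp
      then have "emeasure (N e) (space (N e)) = 0" by (subst (asm) AE_iff_measurable[of "space (N e)"]) auto
      then show False using emN[OF e] \<mu> by (simp add: spN)
    qed
    ultimately show ?thesis unfolding eq by (simp only: less_le) auto
  qed
  \<comment> \<open>\<open>(u, 1)\<close> is the direction of the line through the barycenters of the two halves, and \<open>z\<close> is
    its intersection with the hyperplane.\<close>
  define u where "u i = (\<beta> 1 i - \<beta> (-1) i) / (\<beta> 1 j - \<beta> (-1) j)" for i
  define z where "z i = (if i = j then m else (\<beta> 1 i - (\<beta> 1 j - m * \<mu>) * u i) / \<mu>)" for i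
  have d: "\<beta> 1 j - \<beta> (-1) j > 0" using side[of 1] side[of "-1"] by simp
  have zj: "z j = m" by (simp add: z_def)
  have barI: "integrable (N e) (\<lambda>x. x i - z i - (x j - z j) * u i)"
    "(\<integral>x. x i - z i - (x j - z j) * u i \<partial>N e) = 0" if i: "i \<in> I" and e: "e \<in> {1, -1}" for i e
  proof -
    interpret finite_measure "N e" by (rule finN[OF e])
    have ints: "integrable (N e) (\<lambda>x. x i)" "integrable (N e) (\<lambda>x. x j)" using i intN by auto
    then show "integrable (N e) (\<lambda>x. x i - z i - (x j - z j) * u i)" by simp
    have "(\<integral>x. x i - z i - (x j - z j) * u i \<partial>N e) = \<beta> e i - z i * \<mu> - (\<beta> e j - m * \<mu>) * u i"
      using ints mN[OF e] by (simp add: \<beta>_def zj mult.commute)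
    also have "z i * \<mu> = \<beta> 1 i - (\<beta> 1 j - m * \<mu>) * u i"
      using i I \<mu> by (auto simp: z_def)
    also have "\<beta> e i - (\<beta> 1 i - (\<beta> 1 j - m * \<mu>) * u i) - (\<beta> e j - m * \<mu>) * u i
        = (\<beta> e i - \<beta> 1 i) + (\<beta> 1 j - \<beta> e j) * u i" by (simp add: algebra_simps)
    \<comment> \<open>For \<open>e = 1\<close> both differences vanish; for \<open>e = -1\<close>
      this is the equation that defines \<open>u i\<close>.\<close>
    also have "\<dots> = 0" using e d by (auto simp: u_def)
    finally show "(\<integral>x. x i - z i - (x j - z j) * u i \<partial>N e) = 0" .
  qed
  show ?thesis
  proof (rule that[of z])
    fix g assume g[measurable]: "g \<in> borel_measurable ?P"
      and dual: "\<And>x y. x \<in> space ?P \<Longrightarrow> y \<in> space ?P \<Longrightarrow>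
        f x * g y \<le> ennreal (exp (- (\<Sum>i\<in>insert j I. (x i - z i) * y i)))"
    define G where "G e = (\<integral>\<^sup>+y. g y * indicator {y. e * (y j + (\<Sum>i\<in>I. u i * y i)) \<ge> 0} y \<partial>?P)" for e :: real
    define C where "C = pi / 2 * (2 * pi) ^ card I"
    have half: "ennreal \<mu> * G e \<le> ennreal C" if e: "e \<in> {1, -1}" for e
    proof -
      have "(\<integral>\<^sup>+x. f x * indicator {x. e * (x j - z j) > 0} x \<partial>?P) * G e \<le> ennreal C"
        unfolding G_def C_def
        by (rule half_space_santalo[OF I IH f g, where N = "N e"])
          (use e M barI[OF _ e] dual in \<open>auto simp: N_def zj\<close>)
      then show ?thesis using m[OF e] by (simp add: zj \<mu>_def)
    qed
    have sm[measurable]: "(\<lambda>y. \<Sum>i\<in>I. u i * y i) \<in> borel_measurable ?P"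
      using comp by (intro borel_measurable_sum borel_measurable_times) auto
    \<comment> \<open>The two closed half-spaces cover everything; counting their common boundary
      twice only helps the upper bound.\<close>
    have "(\<integral>\<^sup>+y. g y \<partial>?P) \<le> (\<integral>\<^sup>+y. g y * indicator {y. 1 * (y j + (\<Sum>i\<in>I. u i * y i)) \<ge> 0} y
        + g y * indicator {y. (- 1) * (y j + (\<Sum>i\<in>I. u i * y i)) \<ge> 0} y \<partial>?P)"
      by (intro nn_integral_mono) (auto simp: indicator_def)
    also have "\<dots> = G 1 + G (- 1)"
      unfolding G_def by (rule nn_integral_add) measurable
    finally have "(\<integral>\<^sup>+x. f x \<partial>?P) * (\<integral>\<^sup>+y. g y \<partial>?P) \<le> ennreal M * (G 1 + G (- 1))"
      unfolding M by (rule mult_left_mono) simp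
    also have "ennreal M = 2 * ennreal \<mu>"
      using \<mu> ennreal_mult'[of 2 \<mu>] by (simp add: \<mu>_def)
    also have "2 * ennreal \<mu> * (G 1 + G (- 1)) = 2 * (ennreal \<mu> * G 1 + ennreal \<mu> * G (- 1))"
      by (simp add: distrib_left mult.assoc)
    \<comment> \<open>With \<open>M = 2 * \<mu>\<close> the total is \<open>4 * C\<close>, and
      \<open>4 * (pi / 2)\<close> is the factor \<open>2 * pi\<close> for the new dimension.\<close>
    also have "\<dots> \<le> 2 * (ennreal C + ennreal C)"
      by (intro mult_left_mono add_mono half) auto
    also have "\<dots> = ennreal (2 * (C + C))"
    proof -
      have "C \<ge> 0" by (simp add: C_def)
      then show ?thesis using ennreal_mult'[of 2 "C + C"] ennreal_plus[of C C] by (simp del: ennreal_plus add: ennreal_plus[symmetric])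
    qed
    also have "2 * (C + C) = (2 * pi) ^ card (insert j I)" using I by (simp add: C_def)
    finally show "(\<integral>\<^sup>+x. f x \<partial>?P) * (\<integral>\<^sup>+y. g y \<partial>?P) \<le> ennreal ((2 * pi) ^ card (insert j I))" .
  qed
qed

section \<open>Removing the translation, and the induction on the dimension\<close>

text \<open>Jensen's inequality without normalising the mass: integrate
  \<open>1 + l x \<le> exp (l x)\<close> against the density, where \<open>l\<close> has mean 0. If
  the tilted integral is infinite, there is nothing to show.\<close>

lemma nn_integral_le_exp_tilt:
  assumes f[measurable]: "f \<in> borel_measurable M" and fin: "(\<integral>\<^sup>+x. f x \<partial>M) < \<infinity>"
    and l[measurable]: "l \<in> borel_measurable M"
    and int: "integrable (density M f) l" and zero: "(\<integral>x. l x \<partial>density M f) = 0"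
  shows "(\<integral>\<^sup>+x. f x \<partial>M) \<le> (\<integral>\<^sup>+x. f x * ennreal (exp (l x)) \<partial>M)"
proof -
  let ?D = "density M f"
  have tilt: "(\<integral>\<^sup>+x. ennreal (exp (l x)) \<partial>?D) = (\<integral>\<^sup>+x. f x * ennreal (exp (l x)) \<partial>M)"
    by (subst nn_integral_density) simp_all
  have mass: "emeasure ?D (space M) = (\<integral>\<^sup>+x. f x \<partial>M)"
    by (subst emeasure_density) (auto intro!: nn_integral_cong)
  interpret finite_measure ?D
    by (rule finite_measureI) (use fin mass in auto)
  show ?thesis
  proof (cases "(\<integral>\<^sup>+x. ennreal (exp (l x)) \<partial>?D) < \<infinity>")
    case True
    then have ie: "integrable ?D (\<lambda>x. exp (l x))" by (simp add: integrable_iff_bounded)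
    have "measure ?D (space ?D) = (\<integral>x. 1 + l x \<partial>?D)" using int zero by simp
    also have "\<dots> \<le> (\<integral>x. exp (l x) \<partial>?D)"
      using int ie by (intro integral_mono) (auto simp: exp_ge_add_one_self)
    finally have "ennreal (measure ?D (space ?D)) \<le> ennreal (\<integral>x. exp (l x) \<partial>?D)" by (rule ennreal_leI)
    also have "\<dots> = (\<integral>\<^sup>+x. ennreal (exp (l x)) \<partial>?D)"
      using ie by (intro nn_integral_eq_integral[symmetric]) auto
    finally show ?thesis by (simp add: tilt mass emeasure_eq_measure[symmetric])
  next
    case False
    then show ?thesis by (simp add: tilt[symmetric] not_less top_unique)
  qed
qed

text \<open>In dimension zero the measure is a unit point mass, and the claim is the duality
  relation itself.\<close>

lemma santalo_on_empty: "santalo_on {}"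
  unfolding santalo_on_def by (simp add: PiM_empty nn_integral_count_space_finite)

text \<open>The centred function is \<open>f\<close>, so the function cut by a median hyperplane is
  \<open>g\<close>. As \<open>g\<close> may have infinite mass or no first moments, it is first
  truncated in height and to a box; the bound for the truncations passes to \<open>g\<close> by
  monotone convergence.\<close>

lemma santalo_on_insert:
  fixes I :: "'i set"
  assumes I: "finite I" "j \<notin> I" and IH: "santalo_on I"
  shows "santalo_on (insert j I)"
  unfolding santalo_on_def
proof (intro ballI impI)
  let ?P = "lborel_PiM (insert j I)"
  fix f g :: "('i \<Rightarrow> real) \<Rightarrow> ennreal"
  assume f[measurable]: "f \<in> borel_measurable ?P" and g[measurable]: "g \<in> borel_measurable ?P"
    and fin: "(\<integral>\<^sup>+x. f x \<partial>?P) < \<infinity>"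
    and bar: "\<forall>i\<in>insert j I. integrable (density ?P f) (\<lambda>x. x i) \<and> (\<integral>x. x i \<partial>density ?P f) = 0"
    and dual: "\<forall>x\<in>space ?P. \<forall>y\<in>space ?P. f x * g y \<le> ennreal (exp (- (\<Sum>i\<in>insert j I. x i * y i)))"
  define C where "C = ennreal ((2 * pi) ^ card (insert j I))"
  define W where "W k = (\<Pi>\<^sub>E i\<in>insert j I. {- real k..real k})" for k
  have W[measurable]: "W k \<in> sets ?P" for k
    unfolding W_def using I by (intro sets_PiM_I_finite) auto
  have UW: "(\<Union>k. W k) = space ?P"
  proof (intro set_eqI iffI)
    fix x assume x: "x \<in> space ?P"
    obtain k :: nat where k: "(\<Sum>i\<in>insert j I. \<bar>x i\<bar>) \<le> real k" using real_arch_simple by blast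
    have "\<bar>x i\<bar> \<le> real k" if "i \<in> insert j I" for i
      using member_le_sum[OF that, of "\<lambda>i. \<bar>x i\<bar>"] I k by simp
    then have "x \<in> W k" using x unfolding W_def space_PiM PiE_iff by (auto simp: abs_le_iff minus_le_iff)
    then show "x \<in> (\<Union>k. W k)" by auto
  qed (auto simp: W_def space_PiM)
  have comp[measurable]: "(\<lambda>x. x i) \<in> borel_measurable ?P" if "i \<in> insert j I" for i
    using measurable_component_singleton[OF that, of "\<lambda>_. lborel :: real measure"] by simp
  have trunc: "(\<integral>\<^sup>+x. min (g x) (of_nat k) * indicator (W k) x \<partial>?P) * (\<integral>\<^sup>+x. f x \<partial>?P) \<le> C" for k
  \<comment> \<open>The median argument needs positive mass; without mass the bound is
    trivial.\<close>
  proof (cases "(\<integral>\<^sup>+x. min (g x) (of_nat k) * indicator (W k) x \<partial>?P) = 0")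
    case False
    define h where "h x = min (g x) (of_nat k) * indicator (W k) x" for x
    have h[measurable]: "h \<in> borel_measurable ?P" unfolding h_def[abs_def] by measurable
    have "emeasure ?P (W k) = (\<Prod>i\<in>insert j I. emeasure lborel {- real k..real k})"
      unfolding W_def using I
      by (intro product_sigma_finite.emeasure_PiM[OF product_sigma_finite_lborel]) auto
    also have "\<dots> < \<infinity>" by (simp add: emeasure_lborel_Icc_eq ennreal_power)
    finally have Wfin: "emeasure ?P (W k) < \<infinity>" .
    have "(\<integral>\<^sup>+x. h x \<partial>?P) \<le> (\<integral>\<^sup>+x. of_nat k * indicator (W k) x \<partial>?P)"
      unfolding h_def by (intro nn_integral_mono mult_right_mono) auto
    also have "\<dots> < \<infinity>"
      using Wfin by (simp add: nn_integral_cmult_indicator ennreal_mult_less_top of_nat_less_top)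
    finally have hfin: "(\<integral>\<^sup>+x. h x \<partial>?P) < \<infinity>" .
    then obtain M where M: "(\<integral>\<^sup>+x. h x \<partial>?P) = ennreal M" "M \<ge> 0"
      by (cases "\<integral>\<^sup>+x. h x \<partial>?P") auto
    with False have M0: "M > 0" unfolding h_def[symmetric] by (cases "M = 0") auto
    have hint: "integrable (density ?P h) (\<lambda>x. x i)" if i: "i \<in> insert j I" for i
    proof -
      have "emeasure (density ?P h) (space ?P) = (\<integral>\<^sup>+x. h x \<partial>?P)"
        by (subst emeasure_density) (auto intro!: nn_integral_cong)
      then interpret finite_measure "density ?P h"
        using hfin by (intro finite_measureI) simp
      have "AE x in density ?P h. norm (x i) \<le> real k"
      proof (subst AE_density[OF h], intro AE_I2 impI)
        fix x assume "0 < h x"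
        then have "x \<in> W k" by (cases "x \<in> W k") (auto simp: h_def)
        then have "x i \<in> {- real k..real k}" unfolding W_def using i by (rule PiE_mem)
        then show "norm (x i) \<le> real k" by auto
      qed
      then show ?thesis
        using comp[OF i] by (intro integrable_const_bound[where B = "real k"]) auto
    qed
    obtain z where z: "\<And>f'. f' \<in> borel_measurable ?P \<Longrightarrow>
      (\<And>x y. x \<in> space ?P \<Longrightarrow> y \<in> space ?P \<Longrightarrow>
        h x * f' y \<le> ennreal (exp (- (\<Sum>i\<in>insert j I. (x i - z i) * y i)))) \<Longrightarrow>
      (\<integral>\<^sup>+x. h x \<partial>?P) * (\<integral>\<^sup>+y. f' y \<partial>?P) \<le> C"
      unfolding C_def using median_santalo[OF I IH h M(1) M0 hint] by blast
    define l where "l y = (\<Sum>i\<in>insert j I. z i * y i)" for y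
    have l[measurable]: "l \<in> borel_measurable ?P"
      unfolding l_def[abs_def] using comp by (intro borel_measurable_sum borel_measurable_times) auto
    \<comment> \<open>The barycenter of \<open>f\<close> at 0 makes the linear function
      \<open>l\<close> have mean 0, so tilting by \<open>exp l\<close> does not decrease the
      integral.\<close>
    have "(\<integral>\<^sup>+x. f x \<partial>?P) \<le> (\<integral>\<^sup>+x. f x * ennreal (exp (l x)) \<partial>?P)"
    proof (rule nn_integral_le_exp_tilt[OF f fin l])
      show "integrable (density ?P f) l"
        unfolding l_def[abs_def] using bar by (intro Bochner_Integration.integrable_sum) auto
      show "(\<integral>x. l x \<partial>density ?P f) = 0"
        unfolding l_def using bar I(1) by (subst Bochner_Integration.integral_sum) (auto intro!: sum.neutral)
    qed
    then have "(\<integral>\<^sup>+x. h x \<partial>?P) * (\<integral>\<^sup>+x. f x \<partial>?P)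
        \<le> (\<integral>\<^sup>+x. h x \<partial>?P) * (\<integral>\<^sup>+x. f x * ennreal (exp (l x)) \<partial>?P)"
      by (rule mult_left_mono) simp
    \<comment> \<open>The tilt absorbs the translation: multiplied by \<open>exp (l y)\<close>, the
      bound \<open>exp\<close> of minus the pairing of \<open>x\<close> and \<open>y\<close> becomes
      the one for \<open>x - z\<close> and \<open>y\<close>. So the tilted \<open>f\<close> is dual
      to \<open>h\<close> about \<open>z\<close>.\<close>
    also have "\<dots> \<le> C"
    proof (rule z)
      fix x y assume xy: "x \<in> space ?P" "y \<in> space ?P"
      have "h x * (f y * ennreal (exp (l y))) \<le> g x * (f y * ennreal (exp (l y)))"
        by (intro mult_right_mono) (auto simp: h_def indicator_def)
      also have "\<dots> = (f y * g x) * ennreal (exp (l y))" by (simp add: ac_simps)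
      also have "\<dots> \<le> ennreal (exp (- (\<Sum>i\<in>insert j I. y i * x i))) * ennreal (exp (l y))"
        using dual xy by (intro mult_right_mono) auto
      also have "\<dots> = ennreal (exp (- (\<Sum>i\<in>insert j I. y i * x i) + l y))"
        by (simp only: exp_add) (simp add: ennreal_mult')
      also have "- (\<Sum>i\<in>insert j I. y i * x i) + l y = - (\<Sum>i\<in>insert j I. (x i - z i) * y i)"
        unfolding l_def by (simp add: algebra_simps sum_subtractf)
      finally show "h x * (f y * ennreal (exp (l y))) \<le> ennreal (exp (- (\<Sum>i\<in>insert j I. (x i - z i) * y i)))" .
    qed measurable
    finally show ?thesis by (simp add: h_def)
  qed simp
  have "(\<integral>\<^sup>+x. g x * indicator (\<Union>k. W k) x \<partial>?P) * (\<integral>\<^sup>+x. f x \<partial>?P) \<le> C"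
  proof (rule nn_integral_truncation_mult_le[OF g W _ trunc])
    show "incseq W" by (auto simp: incseq_def W_def intro!: PiE_mono)
  qed
  moreover have "(\<integral>\<^sup>+x. g x * indicator (\<Union>k. W k) x \<partial>?P) = (\<integral>\<^sup>+x. g x \<partial>?P)"
    unfolding UW by (intro nn_integral_cong) simp
  ultimately show "(\<integral>\<^sup>+x. f x \<partial>?P) * (\<integral>\<^sup>+y. g y \<partial>?P) \<le> ennreal ((2 * pi) ^ card (insert j I))"
    by (simp add: C_def mult.commute)
qed

lemma santalo_on_finite: "finite I \<Longrightarrow> santalo_on I"
  by (induction I rule: finite_induct) (simp_all add: santalo_on_empty santalo_on_insert)

section \<open>Transfer to Euclidean space\<close>

text \<open>Lebesgue measure is the image of the product measure under the coordinate map
  \<open>\<phi>\<close>, which also carries the coordinate pairing to the inner product. A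
  barycenter at 0 is tested against each basis vector to give the coordinate conditions.\<close>

lemma functional_santalo:
  fixes f g :: "'a::euclidean_space \<Rightarrow> real"
  assumes f[measurable]: "f \<in> borel_measurable borel" and g[measurable]: "g \<in> borel_measurable borel"
    and nn: "\<And>x. f x \<ge> 0" "\<And>y. g y \<ge> 0"
    and dual: "\<And>x y. f x * g y \<le> exp (- (x \<bullet> y))"
    and bar: "has_barycenter f" "barycenter f = 0"
  shows "(\<integral>\<^sup>+x. ennreal (f x) \<partial>lborel) * (\<integral>\<^sup>+y. ennreal (g y) \<partial>lborel) \<le> ennreal ((2 * pi) ^ DIM('a))"
proof -
  let ?P = "lborel_PiM (Basis :: 'a set)"
  define \<phi> :: "('a \<Rightarrow> real) \<Rightarrow> 'a" where "\<phi> x = (\<Sum>b\<in>Basis. x b *\<^sub>R b)" for x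
  have lb: "lborel = distr ?P borel \<phi>" unfolding \<phi>_def[abs_def] by (rule lborel_eq)
  have comp[measurable]: "(\<lambda>x. x b) \<in> borel_measurable ?P" if "b \<in> Basis" for b
    using measurable_component_singleton[OF that, of "\<lambda>_. lborel :: real measure"] by simp
  have \<phi>[measurable]: "\<phi> \<in> ?P \<rightarrow>\<^sub>M borel"
    unfolding \<phi>_def[abs_def] using comp by (intro borel_measurable_sum borel_measurable_scaleR) auto
  have \<phi>b: "\<phi> x \<bullet> b = x b" if "b \<in> Basis" for x b
    using that by (simp add: \<phi>_def)
  have nnint: "(\<integral>\<^sup>+x. h (\<phi> x) \<partial>?P) = (\<integral>\<^sup>+x. h x \<partial>lborel)"
    if [measurable]: "h \<in> borel_measurable borel" for h :: "'a \<Rightarrow> ennreal"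
    by (subst lb) (simp add: nn_integral_distr)
  have mom: "(\<integral>\<^sup>+x. ennreal (norm x * f x) \<partial>lborel) < \<infinity>"
    and mass: "0 < (\<integral>\<^sup>+x. ennreal (f x) \<partial>lborel)" "(\<integral>\<^sup>+x. ennreal (f x) \<partial>lborel) < \<infinity>"
    using bar(1) by (auto simp: has_barycenter_def)
  have intf: "integrable lborel (\<lambda>x. f x *\<^sub>R x)"
    using mom nn by (simp add: integrable_iff_bounded mult.commute)
  have "ennreal (\<integral>x. f x \<partial>lborel) = (\<integral>\<^sup>+x. ennreal (f x) \<partial>lborel)"
    using mass nn by (intro nn_integral_eq_integral[symmetric]) (simp_all add: integrable_iff_bounded)
  \<comment> \<open>The scalar \<open>inverse\<close> in \<open>barycenter\<close> is 0 for zero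
    mass; positive mass lets it be cancelled, leaving a vanishing first moment.\<close>
  then have "(\<integral>x. f x \<partial>lborel) \<noteq> 0" using mass by auto
  then have zero: "(\<integral>x. f x *\<^sub>R x \<partial>lborel) = 0"
    using bar(2) by (simp add: barycenter_def)
  have S: "santalo_on (Basis :: 'a set)" by (rule santalo_on_finite) simp
  have meas: "(\<lambda>x. ennreal (f (\<phi> x))) \<in> borel_measurable ?P" "(\<lambda>x. ennreal (g (\<phi> x))) \<in> borel_measurable ?P"
    by measurable
  have fin: "(\<integral>\<^sup>+x. ennreal (f (\<phi> x)) \<partial>?P) < \<infinity>"
    using mass nnint[of "\<lambda>x. ennreal (f x)"] by simp
  have bar': "integrable (density ?P (\<lambda>x. ennreal (f (\<phi> x)))) (\<lambda>x. x b) \<and>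
      (\<integral>x. x b \<partial>density ?P (\<lambda>x. ennreal (f (\<phi> x)))) = 0" if b: "b \<in> Basis" for b
  proof -
    have [measurable]: "(\<lambda>x. x b) \<in> borel_measurable ?P" by (rule comp[OF b])
    have i: "integrable lborel (\<lambda>x. (f x *\<^sub>R x) \<bullet> b)"
      using intf by (intro integrable_inner_left) simp
    have "integrable ?P (\<lambda>x. (f (\<phi> x) *\<^sub>R \<phi> x) \<bullet> b)"
      using i unfolding lb by (subst (asm) integrable_distr_eq) simp_all
    moreover have "(\<integral>x. (f (\<phi> x) *\<^sub>R \<phi> x) \<bullet> b \<partial>?P) = (\<integral>x. (f x *\<^sub>R x) \<bullet> b \<partial>lborel)"
      unfolding lb by (subst integral_distr) simp_all
    moreover have "(\<integral>x. (f x *\<^sub>R x) \<bullet> b \<partial>lborel) = 0"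
      using integral_inner_left[of b lborel "\<lambda>x. f x *\<^sub>R x"] intf zero by simp
    ultimately show ?thesis
      using b nn by (simp add: integrable_density integral_density \<phi>b)
  qed
  have dual': "ennreal (f (\<phi> x)) * ennreal (g (\<phi> y)) \<le> ennreal (exp (- (\<Sum>b\<in>Basis. x b * y b)))" for x y
  proof -
    have "\<phi> x \<bullet> \<phi> y = (\<Sum>b\<in>Basis. x b * y b)"
      by (subst euclidean_inner) (simp add: \<phi>b)
    then show ?thesis
      using dual[of "\<phi> x" "\<phi> y"] nn by (simp add: ennreal_mult'[symmetric] ennreal_leI)
  qed
  have "(\<integral>\<^sup>+x. ennreal (f (\<phi> x)) \<partial>?P) * (\<integral>\<^sup>+y. ennreal (g (\<phi> y)) \<partial>?P)
      \<le> ennreal ((2 * pi) ^ DIM('a))"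
    by (rule S[unfolded santalo_on_def, rule_format, OF meas fin bar' dual'])
  then show ?thesis
    using nnint[of "\<lambda>x. ennreal (f x)"] nnint[of "\<lambda>x. ennreal (g x)"] by simp
qed

theorem theorem2:
  fixes f g :: "real ^ 'n \<Rightarrow> real"
  assumes "f \<in> borel_measurable borel" and "g \<in> borel_measurable borel"
    and "\<And>x. f x \<ge> 0" and "\<And>y. g y \<ge> 0"
    and "\<And>x y. f x * g y \<le> exp (- (x \<bullet> y))"
    and "(has_barycenter f \<and> barycenter f = 0) \<or> (has_barycenter g \<and> barycenter g = 0)"
  shows "(\<integral>\<^sup>+ x. ennreal (f x) \<partial>lborel) * (\<integral>\<^sup>+ y. ennreal (g y) \<partial>lborel)
           \<le> ennreal ((2 * pi) ^ CARD('n))"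
  using assms(6)
proof
  assume "has_barycenter f \<and> barycenter f = 0"
  then show ?thesis using functional_santalo[of f g] assms by simp
next
  assume g: "has_barycenter g \<and> barycenter g = 0"
  \<comment> \<open>The duality relation is symmetric, so the second case is the first one with the
    functions exchanged.\<close>
  have "g x * f y \<le> exp (- (x \<bullet> y))" for x y
    using assms(5)[of y x] by (simp add: mult.commute inner_commute)
  with g show ?thesis
    using functional_santalo[of g f] assms by (simp add: mult.commute[of "nn_integral lborel (\<lambda>x. ennreal (f x))"])
qed

end
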